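(* Let $(G_n)$ be a sequence of finite simple graphs with $|G_n|\to\infty$, let $F$ be a fixed graph with vertex set $[k]$ and $e(F)>0$, let $0<p\le1$ and let $0<\gamma<1$. Then $(G_n)$ is $p$-quasi-random if and only if there is a sequence $\varepsilon_n\to0$ such that for every $n$ and all subsets $U_1,\dots,U_k\subseteq V(G_n)$ with $|U_i|=\lfloor\gamma|G_n|\rfloor$ for each $i$, $$\Bigl|N(F,G_n;U_1,\dots,U_k)-p^{e(F)}\prod_{i=1}^k|U_i|\Bigr|\le\varepsilon_n|G_n|^k.$$ Moreover, if $\gamma<1/k$, then $(G_n)$ is $p$-quasi-random as soon as this estimate holds for all such $U_1,\dots,U_k$ that in addition are pairwise disjoint.
   Context: All graphs are finite, undirected and simple; $|G|$ is the number of vertices and $e(G)$ the number of edges. For a graph $F$ on $[k]$ and a graph $G$, $N(F,G)$ is the number of injective maps $\varphi:V(F)\to V(G)$ that are graph homomorphisms, and for $U_1,\dots,U_k\subseteq V(G)$, $N(F,G;U_1,\dots,U_k)$ is the number of such maps with $\varphi(i)\in U_i$ for all $i$. A sequence $(G_n)$ with $|G_n|\to\infty$ is $p$-quasi-random if for every graph $F$, $N(F,G_n)=(p^{e(F)}+o(1))|G_n|^{|F|}$. *)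

theory Defs
  imports Complex_Main "HOL-Library.FuncSet"
begin

type_synonym 'a graph = "'a set \<times> 'a set set"

abbreviation verts :: "'a graph \<Rightarrow> 'a set" where
  "verts G \<equiv> fst G"

abbreviation edges :: "'a graph \<Rightarrow> 'a set set" where
  "edges G \<equiv> snd G"

definition simple_graph :: "'a graph \<Rightarrow> bool" where
  "simple_graph G \<longleftrightarrow> finite (verts G) \<and> (\<forall>e\<in>edges G. e \<subseteq> verts G \<and> card e = 2)"

(* The maps are extensional (undefined outside the vertex set of F), so that
   each map from V(F) to V(G) is represented by exactly one HOL function. *)
definition inj_homs :: "'b graph \<Rightarrow> 'a graph \<Rightarrow> ('b \<Rightarrow> 'a) set" where
  "inj_homs F G = {\<phi> \<in> verts F \<rightarrow>\<^sub>E verts G.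
     inj_on \<phi> (verts F) \<and> (\<forall>x y. {x, y} \<in> edges F \<longrightarrow> {\<phi> x, \<phi> y} \<in> edges G)}"

definition num_inj_homs :: "'b graph \<Rightarrow> 'a graph \<Rightarrow> nat" where
  "num_inj_homs F G = card (inj_homs F G)"

definition num_inj_homs_in :: "'b graph \<Rightarrow> 'a graph \<Rightarrow> ('b \<Rightarrow> 'a set) \<Rightarrow> nat" where
  "num_inj_homs_in F G U = card {\<phi> \<in> inj_homs F G. \<forall>i\<in>verts F. \<phi> i \<in> U i}"

(* The sequence d is the o(1) term; it may depend on F. *)
definition quasi_random :: "real \<Rightarrow> (nat \<Rightarrow> 'a graph) \<Rightarrow> bool" where
  "quasi_random p G \<longleftrightarrow>
     filterlim (\<lambda>n. card (verts (G n))) at_top sequentially \<and>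
     (\<forall>(k::nat) (F :: nat graph). simple_graph F \<and> verts F = {1..k} \<longrightarrow>
        (\<exists>d :: nat \<Rightarrow> real. d \<longlonglongrightarrow> 0 \<and>
           (\<forall>n. real (num_inj_homs F (G n)) =
                (p ^ card (edges F) + d n) * real (card (verts (G n))) ^ k)))"

end

theory Submission imports Defs "HOL-Analysis.Weierstrass_Theorems" begin

text \<open>
  Let \<open>W\<close> be the adjacency kernel of \<open>G\<close>, \<open>P = p ^ e(F)\<close>, and call a function of \<open>x : [k] \<rightarrow> V(G)\<close> small if
  its mean against every product \<open>f 1 (x 1) \<cdots> f k (x k)\<close> of functions bounded by 1 is small.
  If \<open>G\<close> is \<open>p\<close>-quasi-random, expanding the 4-cycle density of \<open>W - p\<close> and applying Cauchy-Schwarz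
  twice shows that \<open>W - p\<close> is small in cut norm, and the counting lemma yields all restricted counts.

  Conversely, the hypothesis says that \<open>\<Psi>(x) - P\<close> is small, where \<open>\<Psi>\<close> is the product of \<open>W\<close> over the edges
  of \<open>F\<close>: the size constraint is removed one coordinate at a time, disjointness by partitioning \<open>V(G)\<close>.
  No regularity lemma is needed. Let \<open>s(u, v)\<close> be the symmetrized density of \<open>F\<close> minus an edge rooted
  at \<open>(u, v)\<close>. Then \<open>W s - P\<close> is small, and since \<open>s\<close> is an average of products \<open>a(u) b(v)\<close>,
  multiplication by \<open>s(x i, x j)\<close> preserves smallness; by Weierstrass approximation so does
  multiplication by any continuous function of \<open>s(x i, x j)\<close>. Hence \<open>W\<close> is close in cut norm to
  \<open>w = P / max s P\<close>, and the product \<open>Y\<close> of \<open>w\<close> over the edges of \<open>F\<close> satisfies \<open>Y - P\<close> small, even when tested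
  against \<open>ln Y\<close>. So \<open>ln Y \<approx> ln P\<close> in mean square. As \<open>ln Y - ln P\<close> is the sum over the edges of
  \<open>ln w - ln p\<close> and the cross terms of its second moment are nonnegative, \<open>w \<approx> p\<close> in mean square,
  and \<open>W - p\<close> is small in cut norm.
\<close>

section \<open>Averages over finite sets\<close>

text \<open>Division by zero makes the mean over an empty or infinite set equal to 0.\<close>

definition mean :: "'b set \<Rightarrow> ('b \<Rightarrow> real) \<Rightarrow> real" where
  "mean A f = (\<Sum>x\<in>A. f x) / real (card A)"

lemma mean_cong: "(\<And>x. x \<in> A \<Longrightarrow> f x = g x) \<Longrightarrow> mean A f = mean A g"
  unfolding mean_def by (simp cong: sum.cong)

lemma mean_add: "mean A (\<lambda>x. f x + g x) = mean A f + mean A g"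
  by (simp add: mean_def sum.distrib add_divide_distrib)

lemma mean_diff: "mean A (\<lambda>x. f x - g x) = mean A f - mean A g"
  by (simp add: mean_def sum_subtractf diff_divide_distrib)

lemma mean_minus: "mean A (\<lambda>x. - f x) = - mean A f"
  by (simp add: mean_def sum_negf)

lemma mean_cmult: "mean A (\<lambda>x. c * f x) = c * mean A f"
  by (simp add: mean_def sum_distrib_left[symmetric])

lemma mean_multc: "mean A (\<lambda>x. f x * c) = mean A f * c"
  by (simp add: mean_def sum_distrib_right[symmetric])

lemma mean_divide: "mean A (\<lambda>x. f x / c) = mean A f / c"
  using mean_multc[of A f "1 / c"] by simp

lemma mean_sum: "mean A (\<lambda>x. \<Sum>y\<in>B. f x y) = (\<Sum>y\<in>B. mean A (\<lambda>x. f x y))"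
  unfolding mean_def sum_divide_distrib[symmetric] by (subst sum.swap) simp

lemma mean_swap: "mean A (\<lambda>x. mean B (\<lambda>y. f x y)) = mean B (\<lambda>y. mean A (\<lambda>x. f x y))"
  using mean_sum[where A = A and B = B and f = f] by (simp add: mean_def[of B] mean_divide)

lemma mean_const: "finite A \<Longrightarrow> A \<noteq> {} \<Longrightarrow> mean A (\<lambda>x. c) = c"
  by (simp add: mean_def)

lemma mean_0 [simp]: "mean A (\<lambda>x. 0) = 0"
  by (simp add: mean_def)

lemma mean_mono: "(\<And>x. x \<in> A \<Longrightarrow> f x \<le> g x) \<Longrightarrow> mean A f \<le> mean A g"
  unfolding mean_def by (intro divide_right_mono sum_mono) auto

lemma mean_nonneg: "(\<And>x. x \<in> A \<Longrightarrow> 0 \<le> f x) \<Longrightarrow> 0 \<le> mean A f"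
  unfolding mean_def by (intro divide_nonneg_nonneg sum_nonneg) auto

lemma mean_abs: "\<bar>mean A f\<bar> \<le> mean A (\<lambda>x. \<bar>f x\<bar>)"
  unfolding mean_def by (simp add: divide_right_mono)

lemma mean_le_const:
  assumes "\<And>x. x \<in> A \<Longrightarrow> f x \<le> c" "0 \<le> c" shows "mean A f \<le> c"
proof (cases "finite A \<and> A \<noteq> {}")
  case True
  then show ?thesis using mean_mono[of A f "\<lambda>_. c"] assms(1) by (simp add: mean_const)
next
  case False
  then show ?thesis using assms(2) by (auto simp: mean_def)
qed

lemma mean_abs_le_const:
  assumes "\<And>x. x \<in> A \<Longrightarrow> \<bar>f x\<bar> \<le> c" "0 \<le> c" shows "\<bar>mean A f\<bar> \<le> c"
  using mean_abs[of A f] mean_le_const[of A "\<lambda>x. \<bar>f x\<bar>" c] assms by force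

lemma mean_square_le: "(mean A f)\<^sup>2 \<le> mean A (\<lambda>x. (f x)\<^sup>2)"
proof (cases "finite A \<and> A \<noteq> {}")
  case True
  have "0 \<le> mean A (\<lambda>x. (f x - mean A f)\<^sup>2)" by (rule mean_nonneg) simp
  also have "\<dots> = mean A (\<lambda>x. (f x)\<^sup>2 - 2 * mean A f * f x + (mean A f)\<^sup>2)"
    by (rule mean_cong) (simp add: power2_diff algebra_simps)
  also have "\<dots> = mean A (\<lambda>x. (f x)\<^sup>2) - (mean A f)\<^sup>2"
    using True by (simp add: mean_add mean_diff mean_cmult mean_const power2_eq_square)
  finally show ?thesis by simp
qed (auto simp: mean_def)

text \<open>\<open>(x, v) \<mapsto> (x(i := v), x i)\<close> is an involution of \<open>(I \<rightarrow>\<^sub>E V) \<times> V\<close>.\<close>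

lemma mean_resample:
  fixes \<Phi> :: "('i \<Rightarrow> 'a) \<Rightarrow> real"
  assumes "finite V" "i \<in> I"
  shows "mean (I \<rightarrow>\<^sub>E V) \<Phi> = mean (I \<rightarrow>\<^sub>E V) (\<lambda>x. mean V (\<lambda>v. \<Phi> (x(i := v))))"
proof (cases "V = {}")
  case True
  then have "(I \<rightarrow>\<^sub>E V) = {}" using assms(2) by auto
  then show ?thesis by (simp add: mean_def)
next
  case False
  let ?X = "I \<rightarrow>\<^sub>E V"
  have "(\<Sum>x\<in>?X. \<Sum>v\<in>V. \<Phi> (x(i := v))) = (\<Sum>(x, v)\<in>?X \<times> V. \<Phi> (x(i := v)))"
    by (simp add: sum.cartesian_product)
  also have "\<dots> = (\<Sum>(x, v)\<in>?X \<times> V. \<Phi> x)"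
    by (rule sum.reindex_bij_witness[where i = "\<lambda>(x, v). (x(i := v), x i)"
          and j = "\<lambda>(x, v). (x(i := v), x i)"])
      (use assms(2) in \<open>auto simp: PiE_iff extensional_def\<close>)
  also have "\<dots> = real (card V) * (\<Sum>x\<in>?X. \<Phi> x)"
    by (simp add: sum.cartesian_product[symmetric] sum_distrib_left)
  finally show ?thesis
    using False assms(1) by (simp add: mean_def sum_divide_distrib[symmetric])
qed

lemma mean_resample2:
  assumes "finite V" "i \<in> I" "j \<in> I"
  shows "mean (I \<rightarrow>\<^sub>E V) \<Phi> =
    mean (I \<rightarrow>\<^sub>E V) (\<lambda>x. mean V (\<lambda>u. mean V (\<lambda>v. \<Phi> (x(i := u, j := v)))))"
  by (subst mean_resample[OF assms(1,3)], subst mean_resample[OF assms(1,2)]) simp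

text \<open>Resampling coordinates \<open>i\<close> and \<open>j\<close> leaves an integrand that no
  longer depends on \<open>x\<close>. Through this rule, means over tuples with two active
  coordinates become double means over \<open>V\<close>.\<close>

lemma mean_pair:
  assumes "finite V" "finite I" "i \<in> I" "j \<in> I" "i \<noteq> j"
  shows "mean (I \<rightarrow>\<^sub>E V) (\<lambda>x. K (x i) (x j)) = mean V (\<lambda>u. mean V (\<lambda>v. K u v))"
proof (cases "V = {}")
  case True
  then have "(I \<rightarrow>\<^sub>E V) = {}" using assms(3) by auto
  then show ?thesis using True by (simp add: mean_def)
next
  case False
  then have "(I \<rightarrow>\<^sub>E V) \<noteq> {}" by (simp add: PiE_eq_empty_iff)
  then show ?thesis
    by (subst mean_resample2[OF assms(1,3,4)])
      (use assms in \<open>simp add: mean_const finite_PiE\<close>)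
qed

section \<open>Box and cut norms\<close>

text \<open>A cut norm for functions of several variables, with one test function per coordinate.
  Real test functions bounded by 1, rather than indicators of sets, can absorb any further bounded
  factor that depends on a single coordinate.\<close>

definition box_small :: "'a set \<Rightarrow> 'i set \<Rightarrow> (('i \<Rightarrow> 'a) \<Rightarrow> real) \<Rightarrow> real \<Rightarrow> bool" where
  "box_small V I \<Phi> \<delta> \<longleftrightarrow> (\<forall>f. (\<forall>i\<in>I. \<forall>v\<in>V. \<bar>f i v\<bar> \<le> 1) \<longrightarrow>
     \<bar>mean (I \<rightarrow>\<^sub>E V) (\<lambda>x. \<Phi> x * (\<Prod>i\<in>I. f i (x i)))\<bar> \<le> \<delta>)"

text \<open>The cut norm in its functional form; the version with indicators of two sets is
  equivalent to it up to a factor of 4.\<close>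

definition cut_small :: "'a set \<Rightarrow> ('a \<Rightarrow> 'a \<Rightarrow> real) \<Rightarrow> real \<Rightarrow> bool" where
  "cut_small V K \<delta> \<longleftrightarrow> (\<forall>f g. (\<forall>v\<in>V. \<bar>f v\<bar> \<le> 1) \<and> (\<forall>v\<in>V. \<bar>g v\<bar> \<le> 1) \<longrightarrow>
     \<bar>mean V (\<lambda>u. mean V (\<lambda>v. K u v * f u * g v))\<bar> \<le> \<delta>)"

lemma box_smallI:
  assumes "\<And>f. (\<And>i v. i \<in> I \<Longrightarrow> v \<in> V \<Longrightarrow> \<bar>f i v\<bar> \<le> 1) \<Longrightarrow>
     \<bar>mean (I \<rightarrow>\<^sub>E V) (\<lambda>x. \<Phi> x * (\<Prod>i\<in>I. f i (x i)))\<bar> \<le> \<delta>"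
  shows "box_small V I \<Phi> \<delta>"
  using assms unfolding box_small_def by blast

lemma box_smallD:
  assumes "box_small V I \<Phi> \<delta>" "\<And>i v. i \<in> I \<Longrightarrow> v \<in> V \<Longrightarrow> \<bar>f i v\<bar> \<le> 1"
  shows "\<bar>mean (I \<rightarrow>\<^sub>E V) (\<lambda>x. \<Phi> x * (\<Prod>i\<in>I. f i (x i)))\<bar> \<le> \<delta>"
  using assms unfolding box_small_def by blast

lemma box_small_mean: "box_small V I \<Phi> \<delta> \<Longrightarrow> \<bar>mean (I \<rightarrow>\<^sub>E V) \<Phi>\<bar> \<le> \<delta>"
  using box_smallD[of V I \<Phi> \<delta> "\<lambda>_ _. 1"] by simp

lemma cut_smallI:
  assumes "\<And>f g. (\<And>v. v \<in> V \<Longrightarrow> \<bar>f v\<bar> \<le> 1) \<Longrightarrow> (\<And>v. v \<in> V \<Longrightarrow> \<bar>g v\<bar> \<le> 1) \<Longrightarrow>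
     \<bar>mean V (\<lambda>u. mean V (\<lambda>v. K u v * f u * g v))\<bar> \<le> \<delta>"
  shows "cut_small V K \<delta>"
  using assms unfolding cut_small_def by blast

lemma cut_smallD:
  assumes "cut_small V K \<delta>"
    "\<And>v. v \<in> V \<Longrightarrow> \<bar>f v\<bar> \<le> 1" "\<And>v. v \<in> V \<Longrightarrow> \<bar>g v\<bar> \<le> 1"
  shows "\<bar>mean V (\<lambda>u. mean V (\<lambda>v. K u v * f u * g v))\<bar> \<le> \<delta>"
  using assms unfolding cut_small_def by blast

lemma box_small_add:
  assumes "box_small V I \<Phi> \<delta>" "box_small V I \<Phi>' \<delta>'"
  shows "box_small V I (\<lambda>x. \<Phi> x + \<Phi>' x) (\<delta> + \<delta>')"
proof (rule box_smallI)
  fix f :: "_ \<Rightarrow> _ \<Rightarrow> real" assume f: "\<And>i v. i \<in> I \<Longrightarrow> v \<in> V \<Longrightarrow> \<bar>f i v\<bar> \<le> 1"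
  show "\<bar>mean (I \<rightarrow>\<^sub>E V) (\<lambda>x. (\<Phi> x + \<Phi>' x) * (\<Prod>i\<in>I. f i (x i)))\<bar> \<le> \<delta> + \<delta>'"
    using box_smallD[of V I \<Phi> \<delta> f] box_smallD[of V I \<Phi>' \<delta>' f] assms f
    by (simp add: distrib_right mean_add)
qed

lemma box_small_cmult:
  assumes "box_small V I \<Phi> \<delta>"
  shows "box_small V I (\<lambda>x. c * \<Phi> x) (\<bar>c\<bar> * \<delta>)"
proof (rule box_smallI)
  fix f :: "_ \<Rightarrow> _ \<Rightarrow> real" assume f: "\<And>i v. i \<in> I \<Longrightarrow> v \<in> V \<Longrightarrow> \<bar>f i v\<bar> \<le> 1"
  show "\<bar>mean (I \<rightarrow>\<^sub>E V) (\<lambda>x. (c * \<Phi> x) * (\<Prod>i\<in>I. f i (x i)))\<bar> \<le> \<bar>c\<bar> * \<delta>"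
    using box_smallD[of V I \<Phi> \<delta> f] assms f
    by (simp add: mult.assoc mean_cmult abs_mult mult_left_mono)
qed

lemma box_small_mono: "box_small V I \<Phi> \<delta> \<Longrightarrow> \<delta> \<le> \<delta>' \<Longrightarrow> box_small V I \<Phi> \<delta>'"
  unfolding box_small_def by force

lemma cut_small_mono: "cut_small V K \<delta> \<Longrightarrow> \<delta> \<le> \<delta>' \<Longrightarrow> cut_small V K \<delta>'"
  unfolding cut_small_def by force

lemma abs_prod_le_1:
  fixes f :: "'b \<Rightarrow> real"
  assumes "\<And>i. i \<in> I \<Longrightarrow> \<bar>f i\<bar> \<le> 1" shows "\<bar>prod f I\<bar> \<le> 1"
  unfolding abs_prod using assms by (intro prod_le_1) auto

lemma box_small_L1:
  assumes "mean (I \<rightarrow>\<^sub>E V) (\<lambda>x. \<bar>\<Phi> x\<bar>) \<le> \<delta>"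
  shows "box_small V I \<Phi> \<delta>"
proof (rule box_smallI)
  fix f :: "_ \<Rightarrow> _ \<Rightarrow> real" assume f: "\<And>i v. i \<in> I \<Longrightarrow> v \<in> V \<Longrightarrow> \<bar>f i v\<bar> \<le> 1"
  have "\<bar>mean (I \<rightarrow>\<^sub>E V) (\<lambda>x. \<Phi> x * (\<Prod>i\<in>I. f i (x i)))\<bar>
      \<le> mean (I \<rightarrow>\<^sub>E V) (\<lambda>x. \<bar>\<Phi> x\<bar>)"
  proof (rule order_trans[OF mean_abs], rule mean_mono)
    fix x assume "x \<in> (I \<rightarrow>\<^sub>E V)"
    then have "\<bar>\<Prod>i\<in>I. f i (x i)\<bar> \<le> 1" using f by (intro abs_prod_le_1) auto
    then show "\<bar>\<Phi> x * (\<Prod>i\<in>I. f i (x i))\<bar> \<le> \<bar>\<Phi> x\<bar>"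
      by (simp add: abs_mult mult_left_le)
  qed
  then show "\<bar>mean (I \<rightarrow>\<^sub>E V) (\<lambda>x. \<Phi> x * (\<Prod>i\<in>I. f i (x i)))\<bar> \<le> \<delta>"
    using assms by linarith
qed

text \<open>Edges are unordered, kernels need not be symmetric: an edge is oriented from its minimum
  to its maximum.\<close>

definition edge_prod :: "nat set set \<Rightarrow> (nat set \<Rightarrow> 'a \<Rightarrow> 'a \<Rightarrow> real) \<Rightarrow> (nat \<Rightarrow> 'a) \<Rightarrow> real" where
  "edge_prod E w x = (\<Prod>e\<in>E. w e (x (Min e)) (x (Max e)))"

definition edge_set :: "nat set \<Rightarrow> nat set set \<Rightarrow> bool" where
  "edge_set I E \<longleftrightarrow> finite I \<and> (\<forall>e\<in>E. e \<subseteq> I \<and> card e = 2)"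

lemma edge_set_finite: "edge_set I E \<Longrightarrow> finite E"
  unfolding edge_set_def by (meson Pow_iff finite_Pow_iff finite_subset subsetI)

lemma edge_set_mono: "edge_set I E \<Longrightarrow> E' \<subseteq> E \<Longrightarrow> edge_set I E'"
  unfolding edge_set_def by blast

lemma card_2_Min_Max:
  fixes e :: "nat set"
  assumes "card e = 2"
  shows "Min e \<in> e" "Max e \<in> e" "Min e < Max e" "e = {Min e, Max e}"
proof -
  obtain a b where ab: "e = {a, b}" "a < b"
    using assms by (metis card_2_iff insert_commute nat_neq_iff)
  then show "Min e \<in> e" "Max e \<in> e" "Min e < Max e" "e = {Min e, Max e}"
    by (auto simp: max_def min_def)
qed

lemma edge_setD:
  assumes "edge_set I E" "e \<in> E"
  shows "Min e \<in> I" "Max e \<in> I" "Min e < Max e" "e = {Min e, Max e}"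
    "Min e \<in> e" "Max e \<in> e"
  using assms card_2_Min_Max[of e] unfolding edge_set_def by blast+

lemma edge_prod_bound:
  assumes "edge_set I E" "x \<in> (I \<rightarrow>\<^sub>E V)"
    "\<And>e u v. e \<in> E \<Longrightarrow> u \<in> V \<Longrightarrow> v \<in> V \<Longrightarrow> \<bar>w e u v\<bar> \<le> 1"
  shows "\<bar>edge_prod E w x\<bar> \<le> 1"
  unfolding edge_prod_def using assms edge_setD[OF assms(1)]
  by (intro abs_prod_le_1 assms(3)) (auto simp: PiE_iff)

lemma edge_prod_nonneg_le_1:
  assumes "edge_set I E" "x \<in> (I \<rightarrow>\<^sub>E V)"
    "\<And>e u v. e \<in> E \<Longrightarrow> u \<in> V \<Longrightarrow> v \<in> V \<Longrightarrow> 0 \<le> w e u v \<and> w e u v \<le> 1"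
  shows "0 \<le> edge_prod E w x" "edge_prod E w x \<le> 1"
proof -
  have *: "0 \<le> w e (x (Min e)) (x (Max e)) \<and> w e (x (Min e)) (x (Max e)) \<le> 1" if "e \<in> E" for e
    using assms edge_setD[OF assms(1) that] that by (auto simp: PiE_iff)
  show "0 \<le> edge_prod E w x" "edge_prod E w x \<le> 1"
    unfolding edge_prod_def using * by (auto intro: prod_nonneg prod_le_1)
qed

text \<open>An edge containing both \<open>i\<close> and \<open>j\<close> would be
  \<open>{i, j}\<close>, which is excluded. Hence every edge factor depends on at most one of
  \<open>u\<close> and \<open>v\<close>, and membership of \<open>j\<close> sorts the factors. This
  product form is behind both the counting lemma and the contractivity of rooted densities.\<close>

lemma edge_prod_split:
  assumes E: "edge_set I E" and ij: "i \<noteq> j" "{i, j} \<notin> E"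
  shows "edge_prod E w (x(i := u, j := v)) =
    edge_prod {e\<in>E. j \<notin> e} w (x(i := u)) * edge_prod {e\<in>E. j \<in> e} w (x(j := v))"
proof -
  let ?y = "x(i := u, j := v)"
  have "edge_prod {e\<in>E. j \<notin> e} w ?y = edge_prod {e\<in>E. j \<notin> e} w (x(i := u))"
    unfolding edge_prod_def
  proof (rule prod.cong[OF refl])
    fix e assume "e \<in> {e\<in>E. j \<notin> e}"
    then have "Min e \<noteq> j" "Max e \<noteq> j" using edge_setD[OF E, of e] by auto
    then show "w e (?y (Min e)) (?y (Max e)) = w e ((x(i := u)) (Min e)) ((x(i := u)) (Max e))"
      by simp
  qed
  moreover have "edge_prod {e\<in>E. j \<in> e} w ?y = edge_prod {e\<in>E. j \<in> e} w (x(j := v))"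
    unfolding edge_prod_def
  proof (rule prod.cong[OF refl])
    fix e assume e: "e \<in> {e\<in>E. j \<in> e}"
    then have "i \<notin> e" using ij edge_setD(4)[OF E, of e]
      by (metis (no_types, lifting) doubleton_eq_iff insert_iff mem_Collect_eq singletonD)
    then have "Min e \<noteq> i" "Max e \<noteq> i" using e edge_setD[OF E, of e] by auto
    then show "w e (?y (Min e)) (?y (Max e)) = w e ((x(j := v)) (Min e)) ((x(j := v)) (Max e))"
      by simp
  qed
  moreover have "edge_prod E w ?y = edge_prod {e\<in>E. j \<notin> e} w ?y * edge_prod {e\<in>E. j \<in> e} w ?y"
    unfolding edge_prod_def using edge_set_finite[OF E]
    by (subst prod.union_disjoint[symmetric]) (auto intro: prod.cong)
  ultimately show ?thesis by simp
qed

lemma PiE_upd: "x \<in> (I \<rightarrow>\<^sub>E V) \<Longrightarrow> i \<in> I \<Longrightarrow> v \<in> V \<Longrightarrow> x(i := v) \<in> (I \<rightarrow>\<^sub>E V)"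
  by (auto simp: PiE_iff extensional_def)

lemma prod_remove2:
  assumes "finite I" "i \<in> I" "j \<in> I" "i \<noteq> j"
  shows "prod h I = h i * h j * prod h (I - {i, j})"
proof -
  have "prod h I = h i * prod h (I - {i})" using assms by (simp add: prod.remove)
  also have "prod h (I - {i}) = h j * prod h (I - {i} - {j})"
    using assms by (intro prod.remove) auto
  also have "I - {i} - {j} = I - {i, j}" by auto
  finally show ?thesis by (simp add: mult.assoc)
qed

lemma prod_upd2:
  assumes "finite I" "i \<in> I" "j \<in> I" "i \<noteq> j"
  shows "(\<Prod>l\<in>I. f l ((x(i := u, j := v)) l)) = f i u * f j v * (\<Prod>l\<in>I - {i, j}. f l (x l))"
  using assms by (subst prod_remove2[OF assms]) (auto intro: prod.cong)

section \<open>Comparison of the two norms and the counting lemma\<close>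

lemma cut_small_nonneg: "cut_small V K \<delta> \<Longrightarrow> 0 \<le> \<delta>"
  using cut_smallD[of V K \<delta> "\<lambda>_. 0" "\<lambda>_. 0"] by simp

lemma box_small_nonneg: "box_small V I \<Phi> \<delta> \<Longrightarrow> 0 \<le> \<delta>"
  using box_small_mean by fastforce

lemma cut_imp_box:
  assumes K: "cut_small V K \<delta>" and V: "finite V" and E: "edge_set I E"
    and ij: "i \<in> I" "j \<in> I" "i \<noteq> j" "{i, j} \<notin> E"
    and w: "\<And>e u v. e \<in> E \<Longrightarrow> u \<in> V \<Longrightarrow> v \<in> V \<Longrightarrow> \<bar>w e u v\<bar> \<le> 1"
  shows "box_small V I (\<lambda>x. K (x i) (x j) * edge_prod E w x) \<delta>"
proof (rule box_smallI)
  fix f :: "nat \<Rightarrow> 'a \<Rightarrow> real" assume f: "\<And>i v. i \<in> I \<Longrightarrow> v \<in> V \<Longrightarrow> \<bar>f i v\<bar> \<le> 1"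
  have I: "finite I" using E by (simp add: edge_set_def)
  let ?A = "\<lambda>x u. f i u * edge_prod {e\<in>E. j \<notin> e} w (x(i := u))"
  let ?B = "\<lambda>x v. f j v * edge_prod {e\<in>E. j \<in> e} w (x(j := v))"
  let ?R = "\<lambda>x. \<Prod>l\<in>I - {i, j}. f l (x l)"
  let ?Q = "\<lambda>x. mean V (\<lambda>u. mean V (\<lambda>v. K u v * ?A x u * ?B x v))"
  have eq: "mean (I \<rightarrow>\<^sub>E V) (\<lambda>x. K (x i) (x j) * edge_prod E w x * (\<Prod>l\<in>I. f l (x l)))
     = mean (I \<rightarrow>\<^sub>E V) (\<lambda>x. ?R x * ?Q x)"
  proof (subst mean_resample2[OF V ij(1,2)], rule mean_cong, goal_cases)
    case (1 x)
    have "?R x * ?Q x = mean V (\<lambda>u. mean V (\<lambda>v. ?R x * (K u v * ?A x u * ?B x v)))"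
      by (simp only: mean_cmult)
    then show ?case
      by (simp only: prod_upd2[OF I ij(1-3)] edge_prod_split[OF E ij(3,4)])
        (use ij(3) in \<open>simp add: mult_ac\<close>)
  qed
  have "\<bar>?R x * ?Q x\<bar> \<le> \<delta>" if x: "x \<in> (I \<rightarrow>\<^sub>E V)" for x
  proof -
    have E1: "edge_set I {e\<in>E. j \<notin> e}" "edge_set I {e\<in>E. j \<in> e}"
      using E by (auto intro: edge_set_mono)
    have "\<bar>edge_prod {e\<in>E. j \<notin> e} w (x(i := u))\<bar> \<le> 1" if "u \<in> V" for u
      by (rule edge_prod_bound[OF E1(1) PiE_upd[OF x ij(1) that]]) (use w in auto)
    then have A: "\<bar>?A x u\<bar> \<le> 1" if "u \<in> V" for u
      using f[OF ij(1) that] that unfolding abs_mult by (intro mult_le_one) auto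
    have "\<bar>edge_prod {e\<in>E. j \<in> e} w (x(j := u))\<bar> \<le> 1" if "u \<in> V" for u
      by (rule edge_prod_bound[OF E1(2) PiE_upd[OF x ij(2) that]]) (use w in auto)
    then have B: "\<bar>?B x u\<bar> \<le> 1" if "u \<in> V" for u
      using f[OF ij(2) that] that unfolding abs_mult by (intro mult_le_one) auto
    have "\<bar>?Q x\<bar> \<le> \<delta>" using A B by (intro cut_smallD[OF K]) auto
    moreover have "\<bar>?R x\<bar> \<le> 1" using x f by (intro abs_prod_le_1) auto
    ultimately show ?thesis
      unfolding abs_mult using mult_mono[of "\<bar>?R x\<bar>" 1 "\<bar>?Q x\<bar>" \<delta>] by simp
  qed
  then show "\<bar>mean (I \<rightarrow>\<^sub>E V) (\<lambda>x. K (x i) (x j) * edge_prod E w x * (\<Prod>l\<in>I. f l (x l)))\<bar> \<le> \<delta>"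
    unfolding eq by (intro mean_abs_le_const cut_small_nonneg[OF K])
qed

text \<open>Tests equal to 1 away from \<open>i\<close> and \<open>j\<close> see only the marginal
  of \<Phi> on these two coordinates.\<close>

lemma box_imp_cut:
  assumes \<Phi>: "box_small V I \<Phi> \<delta>" and V: "finite V" and I: "finite I"
    and ij: "i \<in> I" "j \<in> I" "i \<noteq> j"
  shows "cut_small V (\<lambda>u v. mean (I \<rightarrow>\<^sub>E V) (\<lambda>x. \<Phi> (x(i := u, j := v)))) \<delta>"
proof (rule cut_smallI)
  fix f g :: "'a \<Rightarrow> real"
  assume fg: "\<And>v. v \<in> V \<Longrightarrow> \<bar>f v\<bar> \<le> 1" "\<And>v. v \<in> V \<Longrightarrow> \<bar>g v\<bar> \<le> 1"
  define h where "h = (\<lambda>l. if l = i then f else if l = j then g else (\<lambda>_. 1))"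
  have "(\<Prod>l\<in>I - {i, j}. h l (x l)) = 1" for x
    by (rule prod.neutral) (simp add: h_def)
  then have "mean (I \<rightarrow>\<^sub>E V) (\<lambda>x. \<Phi> x * (\<Prod>l\<in>I. h l (x l))) =
     mean (I \<rightarrow>\<^sub>E V) (\<lambda>x. mean V (\<lambda>u. mean V (\<lambda>v. \<Phi> (x(i := u, j := v)) * f u * g v)))"
    by (subst mean_resample2[OF V ij(1,2)], simp only: prod_upd2[OF I ij(1-3)])
      (use ij(3) in \<open>simp add: mult_ac h_def\<close>)
  also have "\<dots> = mean V (\<lambda>u. mean V (\<lambda>v. mean (I \<rightarrow>\<^sub>E V) (\<lambda>x. \<Phi> (x(i := u, j := v))) * f u * g v))"
    by (subst mean_swap, subst (2) mean_swap) (simp add: mean_multc)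
  finally show "\<bar>mean V (\<lambda>u. mean V (\<lambda>v. mean (I \<rightarrow>\<^sub>E V) (\<lambda>x. \<Phi> (x(i := u, j := v))) * f u * g v))\<bar> \<le> \<delta>"
    using box_smallD[OF \<Phi>, of h] fg by (auto simp: h_def)
qed

text \<open>Telescoping over the edges: the hybrid \<open>hyb A\<close> uses \<open>W\<close> on the
  edges of \<open>A\<close> and \<open>w\<close> elsewhere. Moving one edge into \<open>A\<close>
  changes the product by \<open>W - w\<close> at that edge times bounded kernels on the others,
  which \<open>cut_imp_box\<close> bounds by \<delta>.\<close>

lemma counting_lemma:
  assumes K: "cut_small V (\<lambda>u v. W u v - w u v) \<delta>" and V: "finite V" and E: "edge_set I E"
    and W: "\<And>u v. u \<in> V \<Longrightarrow> v \<in> V \<Longrightarrow> \<bar>W u v\<bar> \<le> 1"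
    and w: "\<And>u v. u \<in> V \<Longrightarrow> v \<in> V \<Longrightarrow> \<bar>w u v\<bar> \<le> 1"
  shows "box_small V I (\<lambda>x. edge_prod E (\<lambda>_. W) x - edge_prod E (\<lambda>_. w) x) (real (card E) * \<delta>)"
proof -
  define hyb where "hyb A = (\<lambda>e. if e \<in> A then W else w)" for A :: "nat set set"
  have fE: "finite E" by (rule edge_set_finite[OF E])
  have "box_small V I (\<lambda>x. edge_prod E (hyb A) x - edge_prod E (hyb {}) x) (real (card A) * \<delta>)"
    if "A \<subseteq> E" for A
    using finite_subset[OF that fE] that
  proof (induction A rule: finite_induct)
    case empty
    then show ?case by (simp add: box_small_def)
  next
    case (insert e A)
    note e = edge_setD[OF E, of e]
    have "box_small V I (\<lambda>x. (W (x (Min e)) (x (Max e)) - w (x (Min e)) (x (Max e))) *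
        edge_prod (E - {e}) (hyb A) x) \<delta>"
      using insert.prems e W w
      by (intro cut_imp_box[OF K V edge_set_mono[OF E]]) (auto simp: hyb_def)
    moreover have "edge_prod E (hyb (insert e A)) x - edge_prod E (hyb A) x =
        (W (x (Min e)) (x (Max e)) - w (x (Min e)) (x (Max e))) * edge_prod (E - {e}) (hyb A) x" for x
    proof -
      have 1: "edge_prod E v x = v e (x (Min e)) (x (Max e)) * edge_prod (E - {e}) v x" for v
        unfolding edge_prod_def using insert.prems fE by (intro prod.remove) auto
      have 2: "edge_prod (E - {e}) (hyb (insert e A)) x = edge_prod (E - {e}) (hyb A) x"
        unfolding edge_prod_def by (rule prod.cong) (auto simp: hyb_def)
      show ?thesis
        unfolding 1[of "hyb (insert e A)"] 1[of "hyb A"] 2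
        using insert.hyps by (simp add: hyb_def algebra_simps)
    qed
    ultimately have "box_small V I (\<lambda>x. edge_prod E (hyb (insert e A)) x - edge_prod E (hyb A) x) \<delta>"
      by simp
    from box_small_add[OF this insert.IH] insert show ?case
      by (simp add: algebra_simps)
  qed
  from this[of E] have "box_small V I (\<lambda>x. edge_prod E (hyb E) x - edge_prod E (hyb {}) x) (real (card E) * \<delta>)"
    by simp
  moreover have "edge_prod E (hyb E) x = edge_prod E (\<lambda>_. W) x" "edge_prod E (hyb {}) x = edge_prod E (\<lambda>_. w) x" for x
    by (auto simp: edge_prod_def hyb_def intro: prod.cong)
  ultimately show ?thesis by simp
qed

section \<open>Kernels acting as multipliers on the box norm\<close>

text \<open>The quantification over all \<Phi> and \<delta> makes the property iterable: a product
  with \<open>c\<close> is again an admissible \<Phi>, so powers of \<open>c\<close> can be treated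
  one factor at a time.\<close>

definition contractive :: "'a set \<Rightarrow> 'i set \<Rightarrow> ('a \<Rightarrow> 'a \<Rightarrow> real) \<Rightarrow> bool" where
  "contractive V I c \<longleftrightarrow> (\<forall>i\<in>I. \<forall>j\<in>I. i \<noteq> j \<longrightarrow> (\<forall>\<Phi> \<delta>. box_small V I \<Phi> \<delta> \<longrightarrow>
     box_small V I (\<lambda>x. \<Phi> x * c (x i) (x j)) \<delta>))"

lemma contractiveD:
  "contractive V I c \<Longrightarrow> i \<in> I \<Longrightarrow> j \<in> I \<Longrightarrow> i \<noteq> j \<Longrightarrow> box_small V I \<Phi> \<delta> \<Longrightarrow>
     box_small V I (\<lambda>x. \<Phi> x * c (x i) (x j)) \<delta>"
  unfolding contractive_def by blast

text \<open>For fixed \<open>z\<close> the factors \<open>A z\<close> and \<open>B z\<close> are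
  absorbed into the tests at coordinates \<open>i\<close> and \<open>j\<close>, which stay bounded
  by 1; averaging over \<open>z\<close> preserves the bound.\<close>

lemma contractive_mean:
  assumes I: "finite I"
    and c: "\<And>u v. u \<in> V \<Longrightarrow> v \<in> V \<Longrightarrow> c u v = mean Z (\<lambda>z. A z u * B z v)"
    and A: "\<And>z v. z \<in> Z \<Longrightarrow> v \<in> V \<Longrightarrow> \<bar>A z v\<bar> \<le> 1"
    and B: "\<And>z v. z \<in> Z \<Longrightarrow> v \<in> V \<Longrightarrow> \<bar>B z v\<bar> \<le> 1"
  shows "contractive V I c"
  unfolding contractive_def
proof (intro ballI impI allI box_smallI)
  fix i j \<Phi> \<delta> and f :: "_ \<Rightarrow> _ \<Rightarrow> real"
  assume ij: "i \<in> I" "j \<in> I" "i \<noteq> j" and \<Phi>: "box_small V I \<Phi> \<delta>"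
    and f: "\<And>i v. i \<in> I \<Longrightarrow> v \<in> V \<Longrightarrow> \<bar>f i v\<bar> \<le> 1"
  define h where "h z = (\<lambda>l v. if l = i then f i v * A z v else if l = j then f j v * B z v else f l v)" for z
  have "mean (I \<rightarrow>\<^sub>E V) (\<lambda>x. \<Phi> x * c (x i) (x j) * (\<Prod>i\<in>I. f i (x i)))
     = mean (I \<rightarrow>\<^sub>E V) (\<lambda>x. mean Z (\<lambda>z. \<Phi> x * (\<Prod>i\<in>I. h z i (x i))))"
  proof (rule mean_cong)
    fix x assume "x \<in> (I \<rightarrow>\<^sub>E V)"
    then have "x i \<in> V" "x j \<in> V" using ij by auto
    moreover have "(\<Prod>i\<in>I. h z i (x i)) = A z (x i) * B z (x j) * (\<Prod>i\<in>I. f i (x i))" for z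
    proof -
      have "(\<Prod>l\<in>I - {i, j}. h z l (x l)) = (\<Prod>l\<in>I - {i, j}. f l (x l))"
        by (rule prod.cong) (auto simp: h_def)
      then show ?thesis
        using ij(3) by (subst (1 2) prod_remove2[OF I ij]) (simp add: h_def mult_ac)
    qed
    ultimately show "\<Phi> x * c (x i) (x j) * (\<Prod>i\<in>I. f i (x i))
        = mean Z (\<lambda>z. \<Phi> x * (\<Prod>i\<in>I. h z i (x i)))"
      by (simp add: c mean_cmult mean_multc)
  qed
  also have "\<dots> = mean Z (\<lambda>z. mean (I \<rightarrow>\<^sub>E V) (\<lambda>x. \<Phi> x * (\<Prod>i\<in>I. h z i (x i))))"
    by (rule mean_swap)
  also have "\<bar>\<dots>\<bar> \<le> \<delta>"
  proof (rule mean_abs_le_const[OF box_smallD[OF \<Phi>] box_small_nonneg[OF \<Phi>]])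
    fix z l v assume "z \<in> Z" "l \<in> I" "v \<in> V"
    then show "\<bar>h z l v\<bar> \<le> 1"
      using A[of z v] B[of z v] f[of _ v] ij unfolding h_def by (auto simp: abs_mult intro!: mult_le_one)
  qed
  finally show "\<bar>mean (I \<rightarrow>\<^sub>E V) (\<lambda>x. \<Phi> x * c (x i) (x j) * (\<Prod>i\<in>I. f i (x i)))\<bar> \<le> \<delta>" .
qed

lemma contractive_symmetrize:
  assumes "contractive V I c" shows "contractive V I (\<lambda>u v. (c u v + c v u) / 2)"
  unfolding contractive_def
proof (intro ballI impI allI)
  fix i j \<Phi> \<delta>
  assume ij: "i \<in> I" "j \<in> I" "i \<noteq> j" and \<Phi>: "box_small V I \<Phi> \<delta>"
  show "box_small V I (\<lambda>x. \<Phi> x * ((c (x i) (x j) + c (x j) (x i)) / 2)) \<delta>"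
    using box_small_cmult[OF box_small_add[OF contractiveD[OF assms ij \<Phi>]
          contractiveD[OF assms ij(2,1) ij(3)[symmetric] \<Phi>]], of "1/2"]
    by (simp add: field_simps)
qed

text \<open>The constant depends on the polynomial alone. This uniformity in \<open>V\<close>,
  \<open>c\<close> and \<Phi> allows the use for graphs of growing order. A product of polynomials
  is handled by multiplying twice in succession, so the constants multiply.\<close>

lemma contractive_polynomial:
  assumes "real_polynomial_function g"
  shows "\<exists>C\<ge>0. \<forall>(V :: 'a set) (I :: 'i set) c i j \<Phi> \<delta>. contractive V I c \<and> i \<in> I \<and> j \<in> I \<and> i \<noteq> j \<and>
    box_small V I \<Phi> \<delta> \<longrightarrow> box_small V I (\<lambda>x. \<Phi> x * g (c (x i) (x j))) (C * \<delta>)"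
    (is "\<exists>C\<ge>0. ?P g C")
  using assms
proof (induction rule: real_polynomial_function.induct)
  case (linear g)
  have g: "g t = t * g 1" for t
    using linear_scale[OF bounded_linear.linear[OF linear], of t 1] by simp
  show ?case
  proof (intro exI[of _ "\<bar>g 1\<bar>"] conjI allI impI; (elim conjE)?)
    fix V :: "'a set" and I :: "'i set" and c i j \<Phi> \<delta>
    assume "contractive V I c" "i \<in> I" "j \<in> I" "i \<noteq> j" "box_small V I \<Phi> \<delta>"
    from box_small_cmult[OF contractiveD[OF this], of "g 1"]
    show "box_small V I (\<lambda>x. \<Phi> x * g (c (x i) (x j))) (\<bar>g 1\<bar> * \<delta>)"
      by (subst g) (simp add: mult_ac)
  qed simp
next
  case (const t)
  show ?case
  proof (intro exI[of _ "\<bar>t\<bar>"] conjI allI impI; (elim conjE)?)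
    fix V :: "'a set" and I :: "'i set" and \<Phi> \<delta>
    assume "box_small V I \<Phi> \<delta>"
    from box_small_cmult[OF this, of t] show "box_small V I (\<lambda>x. \<Phi> x * t) (\<bar>t\<bar> * \<delta>)"
      by (simp add: mult_ac)
  qed simp
next
  case (add g h)
  from add.IH(1) obtain C where C: "C \<ge> 0 \<and> ?P g C" ..
  from add.IH(2) obtain D where D: "D \<ge> 0 \<and> ?P h D" ..
  show ?case
  proof (intro exI[of _ "C + D"] conjI allI impI; (elim conjE)?)
    fix V :: "'a set" and I :: "'i set" and c i j \<Phi> \<delta>
    assume "contractive V I c" "i \<in> I" "j \<in> I" "i \<noteq> j" "box_small V I \<Phi> \<delta>"
    then have *: "contractive V I c \<and> i \<in> I \<and> j \<in> I \<and> i \<noteq> j \<and> box_small V I \<Phi> \<delta>" by simp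
    from box_small_add[OF C[THEN conjunct2, rule_format, OF *] D[THEN conjunct2, rule_format, OF *]]
    show "box_small V I (\<lambda>x. \<Phi> x * (g (c (x i) (x j)) + h (c (x i) (x j)))) ((C + D) * \<delta>)"
      by (simp add: distrib_left distrib_right)
  qed (use C D in simp)
next
  case (mult g h)
  from mult.IH(1) obtain C where C: "C \<ge> 0 \<and> ?P g C" ..
  from mult.IH(2) obtain D where D: "D \<ge> 0 \<and> ?P h D" ..
  show ?case
  proof (intro exI[of _ "D * C"] conjI allI impI; (elim conjE)?)
    fix V :: "'a set" and I :: "'i set" and c i j \<Phi> \<delta>
    assume a: "contractive V I c" "i \<in> I" "j \<in> I" "i \<noteq> j" "box_small V I \<Phi> \<delta>"
    then have *: "contractive V I c \<and> i \<in> I \<and> j \<in> I \<and> i \<noteq> j \<and> box_small V I \<Phi> \<delta>" by simp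
    have "contractive V I c \<and> i \<in> I \<and> j \<in> I \<and> i \<noteq> j \<and>
        box_small V I (\<lambda>x. \<Phi> x * g (c (x i) (x j))) (C * \<delta>)"
      using a C[THEN conjunct2, rule_format, OF *] by simp
    from D[THEN conjunct2, rule_format, OF this]
    show "box_small V I (\<lambda>x. \<Phi> x * (g (c (x i) (x j)) * h (c (x i) (x j)))) (D * C * \<delta>)"
      by (simp add: mult.assoc)
  qed (use C D in simp)
qed

text \<open>A polynomial within \<eta> of \<phi> on \<open>{0..1}\<close> is handled by
  \<open>contractive_polynomial\<close>; the approximation error enters in mean absolute value,
  which is why \<Phi> is bounded and \<open>c\<close> takes values in \<open>{0..1}\<close>. The
  constant \<open>C\<close> depends only on \<phi> and \<eta>.\<close>

lemma contractive_continuous: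
  fixes \<phi> :: "real \<Rightarrow> real"
  assumes \<phi>: "continuous_on {0..1} \<phi>" and \<eta>: "\<eta> > 0"
  obtains C where "C \<ge> 0"
    "\<And>(V :: 'a set) (I :: 'i set) c i j \<Phi> \<delta>. contractive V I c \<Longrightarrow> i \<in> I \<Longrightarrow> j \<in> I \<Longrightarrow> i \<noteq> j \<Longrightarrow>
      box_small V I \<Phi> \<delta> \<Longrightarrow> (\<And>u v. u \<in> V \<Longrightarrow> v \<in> V \<Longrightarrow> 0 \<le> c u v \<and> c u v \<le> 1) \<Longrightarrow>
      (\<And>x. x \<in> (I \<rightarrow>\<^sub>E V) \<Longrightarrow> \<bar>\<Phi> x\<bar> \<le> 1) \<Longrightarrow>
      box_small V I (\<lambda>x. \<Phi> x * \<phi> (c (x i) (x j))) (C * \<delta> + \<eta>)"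
proof -
  obtain g where g: "real_polynomial_function g" "\<And>t. t \<in> {0..1} \<Longrightarrow> \<bar>\<phi> t - g t\<bar> < \<eta>"
    using Stone_Weierstrass_real_polynomial_function[OF _ \<phi> \<eta>] by auto
  from contractive_polynomial[OF g(1)]
  obtain C where C: "C \<ge> 0 \<and> (\<forall>(V :: 'a set) (I :: 'i set) c i j \<Phi> \<delta>. contractive V I c \<and> i \<in> I \<and> j \<in> I \<and> i \<noteq> j \<and>
    box_small V I \<Phi> \<delta> \<longrightarrow> box_small V I (\<lambda>x. \<Phi> x * g (c (x i) (x j))) (C * \<delta>))" ..
  show ?thesis
  proof (rule that[of C])
    show "C \<ge> 0" using C by simp
    fix V :: "'a set" and I :: "'i set" and c i j \<Phi> \<delta>
    assume c: "contractive V I c" "i \<in> I" "j \<in> I" "i \<noteq> j" "box_small V I \<Phi> \<delta>"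
      and b: "\<And>u v. u \<in> V \<Longrightarrow> v \<in> V \<Longrightarrow> 0 \<le> c u v \<and> c u v \<le> 1"
      and \<Phi>: "\<And>x. x \<in> (I \<rightarrow>\<^sub>E V) \<Longrightarrow> \<bar>\<Phi> x\<bar> \<le> 1"
    have "box_small V I (\<lambda>x. \<Phi> x * (\<phi> (c (x i) (x j)) - g (c (x i) (x j)))) \<eta>"
    proof (rule box_small_L1, rule mean_le_const)
      fix x assume x: "x \<in> (I \<rightarrow>\<^sub>E V)"
      then have "x i \<in> V" "x j \<in> V" using c by auto
      then have "\<bar>\<phi> (c (x i) (x j)) - g (c (x i) (x j))\<bar> < \<eta>" using g(2) b by simp
      then show "\<bar>\<Phi> x * (\<phi> (c (x i) (x j)) - g (c (x i) (x j)))\<bar> \<le> \<eta>"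
        using mult_mono[OF \<Phi>[OF x] less_imp_le] by (simp add: abs_mult)
    qed (use \<eta> in simp)
    moreover have "box_small V I (\<lambda>x. \<Phi> x * g (c (x i) (x j))) (C * \<delta>)"
      using C[THEN conjunct2, rule_format, of V I c i j \<Phi> \<delta>] c by simp
    ultimately show "box_small V I (\<lambda>x. \<Phi> x * \<phi> (c (x i) (x j))) (C * \<delta> + \<eta>)"
      using box_small_add by (fastforce simp: algebra_simps)
  qed
qed

section \<open>Rules for the cut norm\<close>

lemma cut_small_cong:
  assumes "\<And>u v. u \<in> V \<Longrightarrow> v \<in> V \<Longrightarrow> K u v = K' u v"
  shows "cut_small V K \<delta> \<longleftrightarrow> cut_small V K' \<delta>"
  unfolding cut_small_def using assms by (simp cong: mean_cong)

lemma cut_small_transpose: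
  assumes "cut_small V K \<delta>" shows "cut_small V (\<lambda>u v. K v u) \<delta>"
proof (rule cut_smallI)
  fix f g :: "'a \<Rightarrow> real"
  assume "\<And>v. v \<in> V \<Longrightarrow> \<bar>f v\<bar> \<le> 1" "\<And>v. v \<in> V \<Longrightarrow> \<bar>g v\<bar> \<le> 1"
  then show "\<bar>mean V (\<lambda>u. mean V (\<lambda>v. K v u * f u * g v))\<bar> \<le> \<delta>"
    using cut_smallD[OF assms, of g f] by (subst mean_swap) (simp add: mult_ac)
qed

lemma cut_small_add:
  assumes "cut_small V K \<delta>" "cut_small V K' \<delta>'"
  shows "cut_small V (\<lambda>u v. K u v + K' u v) (\<delta> + \<delta>')"
proof (rule cut_smallI)
  fix f g :: "'a \<Rightarrow> real"
  assume "\<And>v. v \<in> V \<Longrightarrow> \<bar>f v\<bar> \<le> 1" "\<And>v. v \<in> V \<Longrightarrow> \<bar>g v\<bar> \<le> 1"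
  then show "\<bar>mean V (\<lambda>u. mean V (\<lambda>v. (K u v + K' u v) * f u * g v))\<bar> \<le> \<delta> + \<delta>'"
    using cut_smallD[OF assms(1), of f g] cut_smallD[OF assms(2), of f g]
    by (simp add: distrib_right mean_add)
qed

lemma cut_small_cmult:
  assumes "cut_small V K \<delta>"
  shows "cut_small V (\<lambda>u v. c * K u v) (\<bar>c\<bar> * \<delta>)"
proof (rule cut_smallI)
  fix f g :: "'a \<Rightarrow> real"
  assume "\<And>v. v \<in> V \<Longrightarrow> \<bar>f v\<bar> \<le> 1" "\<And>v. v \<in> V \<Longrightarrow> \<bar>g v\<bar> \<le> 1"
  then show "\<bar>mean V (\<lambda>u. mean V (\<lambda>v. c * K u v * f u * g v))\<bar> \<le> \<bar>c\<bar> * \<delta>"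
    using cut_smallD[OF assms(1), of f g]
    by (simp add: mult.assoc mean_cmult abs_mult mult_left_mono)
qed

lemma cut_small_L1:
  assumes "mean V (\<lambda>u. mean V (\<lambda>v. \<bar>K u v\<bar>)) \<le> \<delta>"
  shows "cut_small V K \<delta>"
proof (rule cut_smallI)
  fix f g :: "'a \<Rightarrow> real"
  assume fg: "\<And>v. v \<in> V \<Longrightarrow> \<bar>f v\<bar> \<le> 1" "\<And>v. v \<in> V \<Longrightarrow> \<bar>g v\<bar> \<le> 1"
  have "\<bar>mean V (\<lambda>u. mean V (\<lambda>v. K u v * f u * g v))\<bar>
      \<le> mean V (\<lambda>u. mean V (\<lambda>v. \<bar>K u v * f u * g v\<bar>))"
    by (rule order_trans[OF mean_abs], rule mean_mono, rule mean_abs)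
  also have "\<dots> \<le> mean V (\<lambda>u. mean V (\<lambda>v. \<bar>K u v\<bar>))"
  proof (intro mean_mono)
    fix u v assume "u \<in> V" "v \<in> V"
    then have "\<bar>f u\<bar> * \<bar>g v\<bar> \<le> 1" using fg by (intro mult_le_one) auto
    then show "\<bar>K u v * f u * g v\<bar> \<le> \<bar>K u v\<bar>"
      by (simp add: abs_mult mult.assoc mult_left_le)
  qed
  finally show "\<bar>mean V (\<lambda>u. mean V (\<lambda>v. K u v * f u * g v))\<bar> \<le> \<delta>"
    using assms by linarith
qed

text \<open>Pointwise \<open>t \<le> \<theta> + t\<^sup>2 / \<theta>\<close> for
  \<open>t \<ge> 0\<close>, since either \<open>t \<le> \<theta>\<close> or
  \<open>\<theta> * t \<le> t\<^sup>2\<close>. It stands in for Cauchy-Schwarz: a mean square of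
  order \<open>\<theta>\<^sup>2\<close> yields a mean of order \<theta>.\<close>

lemma mean2_abs_le:
  fixes K :: "'a \<Rightarrow> 'a \<Rightarrow> real"
  assumes "\<theta> > 0"
  shows "mean V (\<lambda>u. mean V (\<lambda>v. \<bar>K u v\<bar>)) \<le> \<theta> + mean V (\<lambda>u. mean V (\<lambda>v. (K u v)\<^sup>2)) / \<theta>"
proof -
  have c: "mean V (\<lambda>u. mean V (\<lambda>v. \<theta>)) \<le> \<theta>"
    using assms by (intro mean_le_const) auto
  have "mean V (\<lambda>u. mean V (\<lambda>v. \<bar>K u v\<bar>)) \<le> mean V (\<lambda>u. mean V (\<lambda>v. \<theta> + (K u v)\<^sup>2 / \<theta>))"
  proof (intro mean_mono)
    fix u v
    have "0 \<le> (\<bar>K u v\<bar> - \<theta>)\<^sup>2 + \<theta> * \<bar>K u v\<bar>" using assms by simp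
    then have "\<theta> * \<bar>K u v\<bar> \<le> \<theta> * \<theta> + (K u v)\<^sup>2"
      by (simp add: power2_eq_square algebra_simps)
    then show "\<bar>K u v\<bar> \<le> \<theta> + (K u v)\<^sup>2 / \<theta>"
      using assms by (simp add: field_simps power2_eq_square)
  qed
  also have "\<dots> \<le> \<theta> + mean V (\<lambda>u. mean V (\<lambda>v. (K u v)\<^sup>2)) / \<theta>"
    using c by (simp add: mean_add mean_divide)
  finally show ?thesis .
qed

lemma cut_imp_box_pair:
  assumes "cut_small V K \<delta>" "finite V" "finite I" "i \<in> I" "j \<in> I" "i \<noteq> (j :: nat)"
  shows "box_small V I (\<lambda>x. K (x i) (x j)) \<delta>"
  using cut_imp_box[OF assms(1,2) _ assms(4-6), of "{}" "\<lambda>_ _ _. 0"] assms(3)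
  by (simp add: edge_set_def edge_prod_def)

lemma box_imp_cut_pair:
  assumes "box_small V I (\<lambda>x. K (x i) (x j)) \<delta>" "finite V" "V \<noteq> {}" "finite I"
    "i \<in> I" "j \<in> I" "i \<noteq> (j :: nat)"
  shows "cut_small V K \<delta>"
proof -
  have "(I \<rightarrow>\<^sub>E V) \<noteq> {}" "finite (I \<rightarrow>\<^sub>E V)"
    using assms by (auto simp: PiE_eq_empty_iff intro: finite_PiE)
  then show ?thesis
    using box_imp_cut[OF assms(1,2,4-7)] assms(7) by (simp add: mean_const)
qed

section \<open>From box norm to cut norm\<close>

text \<open>Two distinct edges have private endpoints; averaging these out leaves either the mean square
  of the marginal of \<open>h\<close> (common vertex) or the square of its mean (disjoint edges).\<close>

lemma mean_edge_pair_nonneg: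
  fixes h :: "'a \<Rightarrow> 'a \<Rightarrow> real"
  assumes E: "edge_set I E" and V: "finite V" and e: "e \<in> E" "e' \<in> E" "e \<noteq> e'"
    and sym: "\<And>u v. u \<in> V \<Longrightarrow> v \<in> V \<Longrightarrow> h u v = h v u"
  shows "0 \<le> mean (I \<rightarrow>\<^sub>E V) (\<lambda>x. h (x (Min e)) (x (Max e)) * h (x (Min e')) (x (Max e')))"
proof -
  have I: "finite I" and c: "card e = 2" "card e' = 2" "e \<subseteq> I" "e' \<subseteq> I"
    using E e by (auto simp: edge_set_def)
  have "finite e" "finite e'" using c I by (auto intro: finite_subset)
  then have "\<not> e \<subseteq> e'" "\<not> e' \<subseteq> e" using c e(3) card_subset_eq by metis+
  then obtain a b where ab: "a \<in> e" "a \<notin> e'" "b \<in> e'" "b \<notin> e" by blast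
  obtain a' where a': "e = {a', a}" "a' \<noteq> a" using c(1) ab(1)
    by (metis card_2_iff insert_commute insert_iff singletonD)
  obtain b' where b': "e' = {b', b}" "b' \<noteq> b" using c(2) ab(3)
    by (metis card_2_iff insert_commute insert_iff singletonD)
  note I' = c(3,4)[unfolded a'(1) b'(1)]
  have sw: "h (x (min s t)) (x (max s t)) = h (x s) (x t)"
    if "x \<in> (I \<rightarrow>\<^sub>E V)" "s \<in> I" "t \<in> I" for x s t
    using sym[OF PiE_mem[OF that(1,2)] PiE_mem[OF that(1,3)]] by (simp add: min_def max_def)
  define m where "m u = mean V (h u)" for u
  have "mean (I \<rightarrow>\<^sub>E V) (\<lambda>x. h (x (Min e)) (x (Max e)) * h (x (Min e')) (x (Max e')))
      = mean (I \<rightarrow>\<^sub>E V) (\<lambda>x. h (x a') (x a) * h (x b') (x b))"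
    unfolding a' b' using I' by (intro mean_cong) (simp add: sw)
  also have "\<dots> = mean (I \<rightarrow>\<^sub>E V) (\<lambda>x. m (x a') * m (x b'))"
  proof -
    have ne: "a' \<noteq> a" "a' \<noteq> b" "b' \<noteq> a" "b' \<noteq> b" "a \<noteq> b" using ab a' b' by auto
    have "mean V (\<lambda>u. mean V (\<lambda>v. h (x a') u * h (x b') v)) = m (x a') * m (x b')" for x
      by (simp add: mean_cmult mean_multc m_def)
    then show ?thesis
      using I' ne by (subst mean_resample2[OF V, of a I b]) auto
  qed
  also have "\<dots> \<ge> 0"
  proof (cases "a' = b'")
    case True
    then show ?thesis by (auto intro: mean_nonneg)
  next
    case False
    have "mean (I \<rightarrow>\<^sub>E V) (\<lambda>x. m (x a') * m (x b')) = mean V m * mean V m"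
      using I' False by (subst mean_pair[OF V I]) (auto simp: mean_cmult mean_multc)
    then show ?thesis by simp
  qed
  finally show ?thesis .
qed

text \<open>Expanding the square, the diagonal terms make up the left side and the cross terms are
  nonnegative by \<open>mean_edge_pair_nonneg\<close>. Thus a small sum over the edges cannot be due
  to cancellation between them.\<close>

lemma second_moment_edges:
  fixes h :: "'a \<Rightarrow> 'a \<Rightarrow> real"
  assumes E: "edge_set I E" and V: "finite V"
    and sym: "\<And>u v. u \<in> V \<Longrightarrow> v \<in> V \<Longrightarrow> h u v = h v u"
  shows "real (card E) * mean V (\<lambda>u. mean V (\<lambda>v. (h u v)\<^sup>2)) \<le>
    mean (I \<rightarrow>\<^sub>E V) (\<lambda>x. (\<Sum>e\<in>E. h (x (Min e)) (x (Max e)))\<^sup>2)"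
proof -
  let ?l = "\<lambda>e x. h (x (Min e)) (x (Max e))"
  have I: "finite I" and fE: "finite E" using E edge_set_finite by (auto simp: edge_set_def)
  have diag: "mean (I \<rightarrow>\<^sub>E V) (\<lambda>x. ?l e x * ?l e x) = mean V (\<lambda>u. mean V (\<lambda>v. (h u v)\<^sup>2))"
    if "e \<in> E" for e
    using edge_setD[OF E that] by (subst mean_pair[OF V I]) (auto simp: power2_eq_square)
  have "real (card E) * mean V (\<lambda>u. mean V (\<lambda>v. (h u v)\<^sup>2)) =
     (\<Sum>e\<in>E. mean (I \<rightarrow>\<^sub>E V) (\<lambda>x. ?l e x * ?l e x))"
    by (simp add: diag)
  also have "\<dots> \<le> (\<Sum>e\<in>E. \<Sum>e'\<in>E. mean (I \<rightarrow>\<^sub>E V) (\<lambda>x. ?l e x * ?l e' x))"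
  proof (rule sum_mono)
    fix e assume e: "e \<in> E"
    have "mean (I \<rightarrow>\<^sub>E V) (\<lambda>x. ?l e x * ?l e' x) \<ge> 0" if "e' \<in> E" for e'
      using mean_edge_pair_nonneg[OF E V e that] sym
      by (cases "e = e'") (auto intro: mean_nonneg)
    then show "mean (I \<rightarrow>\<^sub>E V) (\<lambda>x. ?l e x * ?l e x) \<le>
        (\<Sum>e'\<in>E. mean (I \<rightarrow>\<^sub>E V) (\<lambda>x. ?l e x * ?l e' x))"
      by (intro member_le_sum[OF e _ fE, of "\<lambda>e'. mean (I \<rightarrow>\<^sub>E V) (\<lambda>x. ?l e x * ?l e' x)"]) auto
  qed
  also have "\<dots> = mean (I \<rightarrow>\<^sub>E V) (\<lambda>x. (\<Sum>e\<in>E. ?l e x)\<^sup>2)"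
    by (simp add: power2_eq_square sum_product mean_sum)
  finally show ?thesis .
qed

section \<open>Rooted densities and the reciprocal kernel\<close>

lemma mean_bounds:
  assumes "finite A" "A \<noteq> {}" "\<And>x. x \<in> A \<Longrightarrow> 0 \<le> f x \<and> f x \<le> 1"
  shows "0 \<le> mean A f" "mean A f \<le> 1"
  using assms mean_mono[of A f "\<lambda>_. 1"] mean_const[of A 1] by (auto intro: mean_nonneg)

text \<open>\<open>s u v\<close> is the symmetrized density of the graph minus an edge, rooted at \<open>u\<close> and \<open>v\<close>.\<close>

lemma rooted_density:
  fixes W :: "'a \<Rightarrow> 'a \<Rightarrow> real"
  assumes E: "edge_set I E" and E0: "E \<noteq> {}" and V: "finite V" "V \<noteq> {}"
    and sym: "\<And>u v. u \<in> V \<Longrightarrow> v \<in> V \<Longrightarrow> W u v = W v u"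
    and W: "\<And>u v. u \<in> V \<Longrightarrow> v \<in> V \<Longrightarrow> 0 \<le> W u v \<and> W u v \<le> 1"
    and box: "box_small V I (\<lambda>x. edge_prod E (\<lambda>_. W) x - P) \<delta>"
  obtains s where "\<And>u v. s u v = s v u" "\<And>u v. u \<in> V \<Longrightarrow> v \<in> V \<Longrightarrow> 0 \<le> s u v \<and> s u v \<le> 1"
    "contractive V I s" "cut_small V (\<lambda>u v. W u v * s u v - P) \<delta>"
proof -
  obtain e0 where e0: "e0 \<in> E" using E0 by blast
  define a b where "a = Min e0" and "b = Max e0"
  have ab: "a \<in> I" "b \<in> I" "a \<noteq> b" "e0 = {a, b}"
    using edge_setD[OF E e0] by (auto simp: a_def b_def)
  have I: "finite I" and fE: "finite E" using E edge_set_finite by (auto simp: edge_set_def)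
  let ?X = "I \<rightarrow>\<^sub>E V"
  have X: "finite ?X" "?X \<noteq> {}" using I V by (auto simp: PiE_eq_empty_iff intro: finite_PiE)
  define c where "c u v = mean ?X (\<lambda>x. edge_prod (E - {e0}) (\<lambda>_. W) (x(a := u, b := v)))" for u v
  have E': "edge_set I (E - {e0})" using E by (rule edge_set_mono) auto
  have Wb: "\<And>u v. u \<in> V \<Longrightarrow> v \<in> V \<Longrightarrow> \<bar>W u v\<bar> \<le> 1" using W by force
  have upd: "x(a := u, b := v) \<in> ?X" if "x \<in> ?X" "u \<in> V" "v \<in> V" for x u v
    using that ab by (intro PiE_upd)
  have c01: "0 \<le> c u v \<and> c u v \<le> 1" if "u \<in> V" "v \<in> V" for u v
    unfolding c_def using that
    by (intro conjI mean_bounds X edge_prod_nonneg_le_1[OF E' upd] W)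
  \<comment> \<open>The averaging set is the set of all maps \<open>x\<close> itself: with
    \<open>e0\<close> removed no edge joins \<open>a\<close> to \<open>b\<close>, so for each
    \<open>x\<close> the integrand is a function of \<open>u\<close> times a function of
    \<open>v\<close>.\<close>
  have con: "contractive V I c"
  proof (rule contractive_mean[OF I])
    fix u v assume "u \<in> V" "v \<in> V"
    show "c u v = mean ?X (\<lambda>x. edge_prod {e\<in>E - {e0}. b \<notin> e} (\<lambda>_. W) (x(a := u)) *
        edge_prod {e\<in>E - {e0}. b \<in> e} (\<lambda>_. W) (x(b := v)))"
      unfolding c_def using ab by (subst edge_prod_split[OF E']) auto
  next
    fix x v assume "x \<in> ?X" "v \<in> V"
    then show "\<bar>edge_prod {e\<in>E - {e0}. b \<notin> e} (\<lambda>_. W) (x(a := v))\<bar> \<le> 1"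
      using Wb by (intro edge_prod_bound[OF edge_set_mono[OF E'] PiE_upd[OF _ ab(1)]]) auto
  next
    fix x v assume "x \<in> ?X" "v \<in> V"
    then show "\<bar>edge_prod {e\<in>E - {e0}. b \<in> e} (\<lambda>_. W) (x(b := v))\<bar> \<le> 1"
      using Wb by (intro edge_prod_bound[OF edge_set_mono[OF E'] PiE_upd[OF _ ab(2)]]) auto
  qed
  have "mean ?X (\<lambda>x. edge_prod E (\<lambda>_. W) (x(a := u, b := v)) - P) = W u v * c u v - P" for u v
  proof -
    have "edge_prod E (\<lambda>_. W) (x(a := u, b := v))
        = W u v * edge_prod (E - {e0}) (\<lambda>_. W) (x(a := u, b := v))" for x
      unfolding edge_prod_def using ab(3)
      by (subst prod.remove[OF fE e0]) (simp add: a_def[symmetric] b_def[symmetric])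
    then show ?thesis using X by (simp add: mean_diff mean_cmult mean_const c_def)
  qed
  then have cut: "cut_small V (\<lambda>u v. W u v * c u v - P) \<delta>"
    using box_imp_cut[OF box V(1) I ab(1-3)] by simp
  \<comment> \<open>\<open>c\<close> need not be symmetric, but \<open>W\<close> is, so
    \<open>W\<close> times the transpose of \<open>c\<close> obeys the same bound and the two can be
    averaged.\<close>
  have "cut_small V (\<lambda>u v. W v u * c v u - P) \<delta>"
    using cut_small_transpose[OF cut] by simp
  then have "cut_small V (\<lambda>u v. W u v * c v u - P) \<delta>"
    by (subst cut_small_cong[of V _ "\<lambda>u v. W v u * c v u - P"]) (auto simp: sym)
  from cut_small_cmult[OF cut_small_add[OF cut this], of "1/2"]
  have "cut_small V (\<lambda>u v. W u v * ((c u v + c v u) / 2) - P) \<delta>"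
    by (simp add: algebra_simps add_divide_distrib)
  moreover have "0 \<le> (c u v + c v u) / 2 \<and> (c u v + c v u) / 2 \<le> 1" if "u \<in> V" "v \<in> V" for u v
    using c01[of u v] c01[of v u] that by simp
  ultimately show ?thesis
    using contractive_symmetrize[OF con] by (intro that[of "\<lambda>u v. (c u v + c v u) / 2"]) simp_all
qed

text \<open>Testing \<open>W s \<approx> P\<close> against \<open>max 0 (P - s)\<close> and using \<open>W s \<le> s\<close> shows that \<open>s \<ge> P\<close> up to a
  small mean error; testing it against \<open>1 / max s P\<close> then gives \<open>W \<approx> P / max s P\<close>.\<close>

lemma reciprocal_cut:
  fixes P \<eta> :: real
  assumes P: "0 < P" "P \<le> 1" and \<eta>: "\<eta> > 0" and I: "finite I" "a \<in> I" "b \<in> I" "a \<noteq> (b :: nat)"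
  obtains \<delta> where "\<delta> > 0"
    "\<And>(V :: 'a set) W s. finite V \<Longrightarrow> V \<noteq> {} \<Longrightarrow>
      (\<And>u v. u \<in> V \<Longrightarrow> v \<in> V \<Longrightarrow> 0 \<le> W u v \<and> W u v \<le> 1) \<Longrightarrow>
      (\<And>u v. u \<in> V \<Longrightarrow> v \<in> V \<Longrightarrow> 0 \<le> s u v \<and> s u v \<le> 1) \<Longrightarrow>
      contractive V I s \<Longrightarrow> cut_small V (\<lambda>u v. W u v * s u v - P) \<delta> \<Longrightarrow>
      cut_small V (\<lambda>u v. W u v - P / max (s u v) P) \<eta>"
proof -
  \<comment> \<open>The final error is \<open>3 * \<theta> / P\<close> plus two terms of at most
    \<open>\<eta> / 4\<close>, that is, \<open>7 / 8 * \<eta>\<close> in all. The first test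
    function is approximated to accuracy \<open>\<theta>\<^sup>2\<close> because passing from mean
    square to mean loses a factor \<theta>.\<close>
  define \<theta> where "\<theta> = P * \<eta> / 8"
  have \<theta>: "\<theta> > 0" using P \<eta> by (simp add: \<theta>_def)
  have co1: "continuous_on {0..1} (\<lambda>t. max 0 (P - t))"
    by (intro continuous_intros)
  have co2: "continuous_on {0..1} (\<lambda>t. 1 / max t P)"
    using P by (intro continuous_intros) auto
  have \<theta>2: "\<theta>\<^sup>2 > 0" and \<eta>4: "\<eta> / 4 > 0" using \<theta> \<eta> by auto
  show ?thesis
  proof (cases rule: contractive_continuous[where ?'a = 'a and ?'i = nat, OF co1 \<theta>2])
    case (1 C1)
    note C1 = this
    show ?thesis
    proof (cases rule: contractive_continuous[where ?'a = 'a and ?'i = nat, OF co2 \<eta>4])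
      case (1 C2)
      note C2 = this
      define \<delta> where "\<delta> = min (\<theta>\<^sup>2 / (C1 + 1)) (\<eta> / 4 / (C2 + 1))"
      have \<delta>: "\<delta> > 0" using C1 C2 \<theta> \<eta> by (simp add: \<delta>_def)
      have "C1 * \<delta> \<le> (C1 + 1) * (\<theta>\<^sup>2 / (C1 + 1))"
        using C1(1) \<delta> by (intro mult_mono) (auto simp: \<delta>_def)
      then have d1: "C1 * \<delta> \<le> \<theta>\<^sup>2" using C1(1) by simp
      define \<kappa> where "\<kappa> = \<eta> / 4"
      have "C2 * \<delta> \<le> (C2 + 1) * (\<kappa> / (C2 + 1))"
        using C2(1) \<delta> by (intro mult_mono) (auto simp: \<delta>_def \<kappa>_def)
      then have d2: "C2 * \<delta> \<le> \<eta> / 4" using C2(1) by (simp add: \<kappa>_def[symmetric])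
      show ?thesis
      proof (rule that[OF \<delta>])
        fix V :: "'a set" and W s :: "'a \<Rightarrow> 'a \<Rightarrow> real"
        assume V: "finite V" "V \<noteq> {}"
          and W: "\<And>u v. u \<in> V \<Longrightarrow> v \<in> V \<Longrightarrow> 0 \<le> W u v \<and> W u v \<le> 1"
          and s: "\<And>u v. u \<in> V \<Longrightarrow> v \<in> V \<Longrightarrow> 0 \<le> s u v \<and> s u v \<le> 1"
          and con: "contractive V I s" and cut: "cut_small V (\<lambda>u v. W u v * s u v - P) \<delta>"
        have box: "box_small V I (\<lambda>x. W (x a) (x b) * s (x a) (x b) - P) \<delta>"
          using cut_imp_box_pair[OF cut V(1) I] .
        have Ws: "0 \<le> W u v * s u v \<and> W u v * s u v \<le> 1 \<and> W u v * s u v \<le> s u v" if "u \<in> V" "v \<in> V" for u v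
          using W[OF that] s[OF that] by (simp add: mult_le_one mult_right_le_one_le mult_left_le_one_le)
        have bd: "\<bar>W (x a) (x b) * s (x a) (x b) - P\<bar> \<le> 1" if "x \<in> (I \<rightarrow>\<^sub>E V)" for x
          using Ws[OF PiE_mem[OF that I(2)] PiE_mem[OF that I(3)]] P by linarith
        let ?d = "\<lambda>u v. max 0 (P - s u v)"
        have "\<bar>mean V (\<lambda>u. mean V (\<lambda>v. (W u v * s u v - P) * ?d u v))\<bar> \<le> C1 * \<delta> + \<theta>\<^sup>2"
          using box_small_mean[OF C1(2)[OF con I(2-4) box s bd]]
            mean_pair[OF V(1) I, of "\<lambda>u v. (W u v * s u v - P) * ?d u v"] by simp
        moreover have "mean V (\<lambda>u. mean V (\<lambda>v. (?d u v)\<^sup>2)) \<le> mean V (\<lambda>u. mean V (\<lambda>v. - ((W u v * s u v - P) * ?d u v)))"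
        proof (intro mean_mono)
          fix u v assume "u \<in> V" "v \<in> V"
          then have "(P - s u v) * ?d u v \<le> (P - W u v * s u v) * ?d u v"
            using Ws[of u v] by (intro mult_right_mono) auto
          moreover have "(?d u v)\<^sup>2 = (P - s u v) * ?d u v" by (simp add: max_def power2_eq_square)
          ultimately show "(?d u v)\<^sup>2 \<le> - ((W u v * s u v - P) * ?d u v)" by (simp add: algebra_simps)
        qed
        ultimately have "mean V (\<lambda>u. mean V (\<lambda>v. (?d u v)\<^sup>2)) \<le> 2 * \<theta>\<^sup>2"
          using d1 by (simp add: mean_minus)
        then have "mean V (\<lambda>u. mean V (\<lambda>v. (?d u v)\<^sup>2)) / \<theta> \<le> 2 * \<theta>"
          using \<theta> by (simp add: divide_le_eq power2_eq_square)
        with mean2_abs_le[OF \<theta>, of V ?d] have d: "mean V (\<lambda>u. mean V (\<lambda>v. ?d u v)) \<le> 3 * \<theta>"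
          by simp
        have "cut_small V (\<lambda>u v. W u v * ?d u v / P) (3 * \<theta> / P)"
        proof (rule cut_small_L1)
          have "mean V (\<lambda>u. mean V (\<lambda>v. \<bar>W u v * ?d u v / P\<bar>)) \<le> mean V (\<lambda>u. mean V (\<lambda>v. ?d u v / P))"
            using W P by (intro mean_mono) (auto simp: abs_mult intro!: divide_right_mono mult_left_le_one_le)
          also have "\<dots> \<le> 3 * \<theta> / P" using d P by (simp add: mean_divide divide_right_mono)
          finally show "mean V (\<lambda>u. mean V (\<lambda>v. \<bar>W u v * ?d u v / P\<bar>)) \<le> 3 * \<theta> / P" .
        qed
        moreover have "cut_small V (\<lambda>u v. (W u v * s u v - P) * (1 / max (s u v) P)) (C2 * \<delta> + \<eta> / 4)"
          by (rule box_imp_cut_pair[OF C2(2)[OF con I(2-4) box] V I]) (use s bd in auto)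
        ultimately have "cut_small V (\<lambda>u v. W u v * ?d u v / P + (W u v * s u v - P) * (1 / max (s u v) P))
            (3 * \<theta> / P + (C2 * \<delta> + \<eta> / 4))" by (rule cut_small_add)
        \<comment> \<open>For \<open>s u v \<le> P\<close> both sides equal
          \<open>W u v - 1\<close>; otherwise the deficit \<open>?d u v\<close> vanishes and both
          equal \<open>W u v - P / s u v\<close>.\<close>
        moreover have "W u v * ?d u v / P + (W u v * s u v - P) * (1 / max (s u v) P) = W u v - P / max (s u v) P" for u v
          using P by (cases "s u v \<le> P") (auto simp: max_def field_simps)
        moreover have "3 * \<theta> / P + (C2 * \<delta> + \<eta> / 4) \<le> \<eta>"
          using d2 P \<eta> by (simp add: \<theta>_def)
        ultimately show "cut_small V (\<lambda>u v. W u v - P / max (s u v) P) \<eta>"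
          by (auto intro: cut_small_mono)
      qed
    qed
  qed
qed

section \<open>Concentration of the reciprocal kernel\<close>

text \<open>The derivative of \<open>exp\<close> is at most 1 on the nonpositive axis. For positive
  numbers up to 1 it follows that closeness of logarithms implies closeness of the numbers.\<close>

lemma exp_diff_le:
  fixes a b :: real assumes "a \<le> 0" "b \<le> 0" shows "\<bar>exp a - exp b\<bar> \<le> \<bar>a - b\<bar>"
proof -
  have *: "exp y - exp x \<le> y - x" if "x \<le> y" "y \<le> 0" for x y :: real
  proof -
    have t: "1 - exp t \<le> - t" for t :: real using exp_ge_add_one_self[of t] by linarith
    have "exp y * (1 - exp (x - y)) \<le> 1 * (1 - exp (x - y))"
      using that by (intro mult_right_mono) auto
    also have "\<dots> \<le> y - x" using t[of "x - y"] by simp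
    finally show ?thesis by (simp add: algebra_simps exp_diff)
  qed
  show ?thesis using *[of a b] *[of b a] assms by (cases "a \<le> b") (auto simp: abs_if)
qed

text \<open>Above \<open>r\<close> the slope of \<open>ln\<close> is at most \<open>1 / r\<close>,
  and \<open>u - v\<close> and \<open>ln u - ln v\<close> have the same sign. The right side is what
  testing \<open>Y - P\<close> against a difference of logarithms produces, so an estimate for it
  bounds a mean square.\<close>

lemma ln_diff_square_le:
  fixes u v r :: real
  assumes "0 < r" "r \<le> u" "r \<le> v" shows "r * (ln u - ln v)\<^sup>2 \<le> (u - v) * (ln u - ln v)"
proof -
  have *: "r * (ln y - ln x) \<le> y - x" if "r \<le> x" "x \<le> y" for x y
  proof -
    have "ln y - ln x \<le> y / x - 1"
      using that assms ln_le_minus_one[of "y / x"] by (simp add: ln_div)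
    then have "x * (ln y - ln x) \<le> y - x" using that assms by (simp add: field_simps)
    moreover have "r * (ln y - ln x) \<le> x * (ln y - ln x)"
      using that assms by (intro mult_right_mono) auto
    ultimately show ?thesis by simp
  qed
  show ?thesis
  proof (cases "u \<le> v")
    case True
    then have "(r * (ln v - ln u)) * (ln v - ln u) \<le> (v - u) * (ln v - ln u)"
      using * assms by (intro mult_right_mono) auto
    then show ?thesis by (simp add: power2_eq_square algebra_simps)
  next
    case False
    then have "(r * (ln u - ln v)) * (ln u - ln v) \<le> (u - v) * (ln u - ln v)"
      using * assms by (intro mult_right_mono) auto
    then show ?thesis by (simp add: power2_eq_square algebra_simps)
  qed
qed

text \<open>With \<open>Y\<close> the product of \<open>w = P / max s P\<close> over the edges, testing \<open>Y \<approx> P\<close> against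
  \<open>ln Y - ln P\<close>, a sum of functions of \<open>s\<close>, bounds the mean of \<open>(ln Y - ln P)\<^sup>2\<close>, and this second
  moment dominates that of \<open>ln w - ln p\<close>.\<close>

lemma constant_density:
  fixes p \<eta> :: real
  assumes E: "edge_set I E" and E0: "E \<noteq> {}" and p: "0 < p" "p \<le> 1" and \<eta>: "\<eta> > 0"
  defines "P \<equiv> p ^ card E"
  obtains \<delta> where "\<delta> > 0"
    "\<And>(V :: 'a set) s. finite V \<Longrightarrow> V \<noteq> {} \<Longrightarrow> (\<And>u v. s u v = s v u) \<Longrightarrow>
      (\<And>u v. u \<in> V \<Longrightarrow> v \<in> V \<Longrightarrow> 0 \<le> s u v \<and> s u v \<le> 1) \<Longrightarrow>
      contractive V I s \<Longrightarrow>
      box_small V I (\<lambda>x. edge_prod E (\<lambda>_ u v. P / max (s u v) P) x - P) \<delta> \<Longrightarrow>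
      cut_small V (\<lambda>u v. P / max (s u v) P - p) \<eta>"
proof -
  have fE: "finite E" by (rule edge_set_finite[OF E])
  have m: "card E > 0" using fE E0 by (simp add: card_gt_0_iff)
  have P: "0 < P" "P \<le> 1" using p by (auto simp: P_def power_le_one)
  \<comment> \<open>Every value of \<open>w\<close> is at least \<open>P\<close>, so
    \<open>r\<close> bounds the product over all edges from below; it also lies below
    \<open>P\<close>, as \<open>ln_diff_square_le\<close> requires.\<close>
  define r where "r = P ^ card E"
  have r: "0 < r" "r \<le> P" unfolding r_def using P m by (auto simp: power_le_imp_le_exp intro: power_decreasing[of 1 "card E" P, simplified])
  have co: "continuous_on {0..1} (\<lambda>t. ln (P / max t P))"
    using P by (intro continuous_intros) (auto simp: max_def)
  \<comment> \<open>Chosen so that the bound \<open>2 * card E * \<epsilon>\<close> on the tested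
    mean turns into \<open>\<eta>\<^sup>2 / 4\<close> for the mean square of \<open>h\<close>;
    \<open>mean2_abs_le\<close> with parameter \<open>\<eta> / 2\<close> then gives exactly
    \<eta>.\<close>
  define \<epsilon> where "\<epsilon> = r * \<eta>\<^sup>2 / 8"
  have \<epsilon>: "\<epsilon> > 0" using r \<eta> by (simp add: \<epsilon>_def)
  show ?thesis
  proof (cases rule: contractive_continuous[where ?'a = 'a and ?'i = nat, OF co \<epsilon>])
    case (1 C)
    note C = this
    \<comment> \<open>The coefficient of \<delta> in the total error: \<open>C\<close> for each
      edge, from testing against \<open>ln w\<close>, and \<open>\<bar>ln P\<bar>\<close> from the
      constant term.\<close>
    define B where "B = card E * C + \<bar>ln P\<bar>"
    have B: "B \<ge> 0" using C by (simp add: B_def)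
    define \<delta> where "\<delta> = card E * \<epsilon> / (B + 1)"
    have \<delta>: "\<delta> > 0" using \<epsilon> m B by (simp add: \<delta>_def)
    have "B * \<delta> \<le> (B + 1) * \<delta>" using \<delta> by (intro mult_right_mono) auto
    also have "\<dots> = card E * \<epsilon>" using B by (simp add: \<delta>_def)
    finally have Bd: "B * \<delta> \<le> card E * \<epsilon>" .
    show ?thesis
    proof (rule that[OF \<delta>])
      fix V :: "'a set" and s :: "'a \<Rightarrow> 'a \<Rightarrow> real"
      assume V: "finite V" "V \<noteq> {}" and sym: "\<And>u v. s u v = s v u"
        and s: "\<And>u v. u \<in> V \<Longrightarrow> v \<in> V \<Longrightarrow> 0 \<le> s u v \<and> s u v \<le> 1"
        and con: "contractive V I s"
        and box: "box_small V I (\<lambda>x. edge_prod E (\<lambda>_ u v. P / max (s u v) P) x - P) \<delta>"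
      define w where "w u v = P / max (s u v) P" for u v
      define h where "h u v = ln (w u v) - ln p" for u v
      have w: "P \<le> w u v \<and> w u v \<le> 1" if "u \<in> V" "v \<in> V" for u v
        using s[OF that] P unfolding w_def by (auto simp: field_simps max_def)
      let ?X = "I \<rightarrow>\<^sub>E V"
      let ?Y = "\<lambda>x. edge_prod E (\<lambda>_. w) x"
      let ?L = "\<lambda>x. \<Sum>e\<in>E. h (x (Min e)) (x (Max e))"
      have box': "box_small V I (\<lambda>x. ?Y x - P) \<delta>"
        using box by (simp add: w_def[abs_def])
      have we: "P \<le> w (x (Min e)) (x (Max e)) \<and> w (x (Min e)) (x (Max e)) \<le> 1" if "x \<in> ?X" "e \<in> E" for x e
        using that edge_setD[OF E that(2)] by (intro w) auto
      have Y: "r \<le> ?Y x" "?Y x \<le> 1" if "x \<in> ?X" for x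
      proof -
        have "(\<Prod>e\<in>E. P) \<le> ?Y x" unfolding edge_prod_def
          using we[OF that] P by (intro prod_mono) auto
        then show "r \<le> ?Y x" by (simp add: r_def)
        show "?Y x \<le> 1" unfolding edge_prod_def
          using we[OF that] P by (intro prod_le_1) force
      qed
      \<comment> \<open>Since \<open>P = p ^ card E\<close>, the constant \<open>ln P\<close> splits
        into one \<open>ln p\<close> per edge, which is the term subtracted in
        \<open>h\<close>.\<close>
      have L: "?L x = ln (?Y x) - ln P" if "x \<in> ?X" for x
      proof -
        have "w (x (Min e)) (x (Max e)) > 0" if "e \<in> E" for e
          using we[OF \<open>x \<in> ?X\<close> that] P by linarith
        then have "ln (?Y x) = (\<Sum>e\<in>E. ln (w (x (Min e)) (x (Max e))))"
          unfolding edge_prod_def using fE by (intro ln_prod) force+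
        then show ?thesis using p by (simp add: h_def sum_subtractf P_def ln_realpow)
      qed
      have bd: "\<bar>?Y x - P\<bar> \<le> 1" if "x \<in> ?X" for x
        using Y[OF that] r P by linarith
      have T1: "\<bar>mean ?X (\<lambda>x. (?Y x - P) * ln (w (x (Min e)) (x (Max e))))\<bar> \<le> C * \<delta> + \<epsilon>" if "e \<in> E" for e
        using box_small_mean[OF C(2)[OF con _ _ _ box' s bd, of "Min e" "Max e"]] edge_setD[OF E that]
        by (simp add: w_def)
      have "mean ?X (\<lambda>x. (?Y x - P) * ?L x) =
          mean ?X (\<lambda>x. (\<Sum>e\<in>E. (?Y x - P) * ln (w (x (Min e)) (x (Max e)))) - (?Y x - P) * ln P)"
        using p by (simp add: h_def sum_subtractf P_def ln_realpow sum_distrib_left right_diff_distrib)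
      also have "\<dots> = (\<Sum>e\<in>E. mean ?X (\<lambda>x. (?Y x - P) * ln (w (x (Min e)) (x (Max e)))))
          - mean ?X (\<lambda>x. ?Y x - P) * ln P"
        by (simp add: mean_diff mean_sum mean_multc)
      also have "\<dots> \<le> (\<Sum>e\<in>E. C * \<delta> + \<epsilon>) + \<delta> * \<bar>ln P\<bar>"
      proof -
        have "(\<Sum>e\<in>E. mean ?X (\<lambda>x. (?Y x - P) * ln (w (x (Min e)) (x (Max e))))) \<le> (\<Sum>e\<in>E. C * \<delta> + \<epsilon>)"
          using T1 by (intro sum_mono) (meson abs_le_D1)
        moreover have "\<bar>mean ?X (\<lambda>x. ?Y x - P) * ln P\<bar> \<le> \<delta> * \<bar>ln P\<bar>"
          unfolding abs_mult using box_small_mean[OF box'] by (intro mult_right_mono) auto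
        ultimately show ?thesis by linarith
      qed
      also have "\<dots> = B * \<delta> + card E * \<epsilon>" by (simp add: B_def algebra_simps)
      finally have T: "mean ?X (\<lambda>x. (?Y x - P) * ?L x) \<le> 2 * card E * \<epsilon>" using Bd by simp
      have "r * (card E * mean V (\<lambda>u. mean V (\<lambda>v. (h u v)\<^sup>2))) \<le> r * mean ?X (\<lambda>x. (?L x)\<^sup>2)"
        using r sym by (intro mult_left_mono second_moment_edges[OF E V(1)]) (auto simp: h_def w_def)
      also have "\<dots> = mean ?X (\<lambda>x. r * (?L x)\<^sup>2)" by (simp add: mean_cmult)
      also have "\<dots> \<le> mean ?X (\<lambda>x. (?Y x - P) * ?L x)"
        using Y r P by (intro mean_mono) (simp add: L ln_diff_square_le)
      also note T
      finally have "card E * (r * mean V (\<lambda>u. mean V (\<lambda>v. (h u v)\<^sup>2))) \<le> card E * (r * (\<eta>\<^sup>2 / 4))"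
        by (simp add: \<epsilon>_def mult_ac)
      then have "mean V (\<lambda>u. mean V (\<lambda>v. (h u v)\<^sup>2)) \<le> \<eta>\<^sup>2 / 4" using m r by simp
      moreover have "mean V (\<lambda>u. mean V (\<lambda>v. (w u v - p)\<^sup>2)) \<le> mean V (\<lambda>u. mean V (\<lambda>v. (h u v)\<^sup>2))"
      proof (intro mean_mono)
        fix u v assume "u \<in> V" "v \<in> V"
        then have "\<bar>exp (ln (w u v)) - exp (ln p)\<bar> \<le> \<bar>ln (w u v) - ln p\<bar>"
          using w[of u v] P p by (intro exp_diff_le) auto
        then have "\<bar>w u v - p\<bar> \<le> \<bar>h u v\<bar>" using w[of u v] \<open>u \<in> V\<close> \<open>v \<in> V\<close> P p by (simp add: h_def)
        then show "(w u v - p)\<^sup>2 \<le> (h u v)\<^sup>2" by (simp add: abs_le_square_iff)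
      qed
      ultimately have "mean V (\<lambda>u. mean V (\<lambda>v. (w u v - p)\<^sup>2)) / (\<eta> / 2) \<le> \<eta> / 2"
        using \<eta> by (simp add: field_simps power2_eq_square)
      then have "cut_small V (\<lambda>u v. w u v - p) \<eta>"
        using mean2_abs_le[of "\<eta> / 2" V "\<lambda>u v. w u v - p"] \<eta> by (intro cut_small_L1) linarith
      then show "cut_small V (\<lambda>u v. P / max (s u v) P - p) \<eta>"
        by (simp add: w_def)
    qed
  qed
qed

text \<open>\<open>rooted_density\<close> produces \<open>s\<close>, \<open>reciprocal_cut\<close>
  replaces \<open>W\<close> by \<open>w\<close>, the counting lemma transfers box smallness from
  \<open>W\<close> to \<open>w\<close>, and \<open>constant_density\<close> replaces
  \<open>w\<close> by \<open>p\<close>. The resulting \<delta> serves all finite vertex sets at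
  once.\<close>

lemma cut_from_box:
  fixes p \<eta> :: real
  assumes E: "edge_set I E" and E0: "E \<noteq> {}" and p: "0 < p" "p \<le> 1" and \<eta>: "\<eta> > 0"
  obtains \<delta> where "\<delta> > 0"
    "\<And>(V :: 'a set) W. finite V \<Longrightarrow> V \<noteq> {} \<Longrightarrow> (\<And>u v. u \<in> V \<Longrightarrow> v \<in> V \<Longrightarrow> W u v = W v u) \<Longrightarrow>
      (\<And>u v. u \<in> V \<Longrightarrow> v \<in> V \<Longrightarrow> 0 \<le> W u v \<and> W u v \<le> 1) \<Longrightarrow>
      box_small V I (\<lambda>x. edge_prod E (\<lambda>_. W) x - p ^ card E) \<delta> \<Longrightarrow>
      cut_small V (\<lambda>u v. W u v - p) \<eta>"
proof -
  define P where "P = p ^ card E"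
  have P: "0 < P" "P \<le> 1" using p by (auto simp: P_def power_le_one)
  have m: "card E > 0" using edge_set_finite[OF E] E0 by (simp add: card_gt_0_iff)
  obtain e0 where e0: "e0 \<in> E" using E0 by blast
  have I: "finite I" "Min e0 \<in> I" "Max e0 \<in> I" "Min e0 \<noteq> Max e0"
    using E edge_setD[OF E e0] by (auto simp: edge_set_def)
  have \<eta>2: "\<eta> / 2 > 0" using \<eta> by simp
  show ?thesis
  proof (cases rule: constant_density[where ?'a = 'a, OF E E0 p \<eta>2])
    case (1 d1)
    note d1 = this[folded P_def]
    \<comment> \<open>Constants are fixed backwards: \<eta> gives \<open>d1\<close>, then
      \<open>\<eta>1\<close>, then \<open>d2\<close>. The counting error
      \<open>card E * \<eta>1\<close> may use half of \<open>d1\<close>; the other half is reserved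
      for the hypothesis on \<open>W\<close>.\<close>
    define \<eta>1 where "\<eta>1 = min (\<eta> / 2) (d1 / 2 / card E)"
    have \<eta>1: "\<eta>1 > 0" using \<eta> d1 m by (simp add: \<eta>1_def)
    have "real (card E) * \<eta>1 \<le> real (card E) * (d1 / 2 / card E)"
      by (intro mult_left_mono) (auto simp: \<eta>1_def)
    then have \<eta>1': "real (card E) * \<eta>1 \<le> d1 / 2" using m by simp
    show ?thesis
    proof (cases rule: reciprocal_cut[where ?'a = 'a, OF P \<eta>1 I])
      case (1 d2)
      note d2 = this
      have d: "min d2 (d1 / 2) > 0" using d1 d2 by simp
      show ?thesis
      proof (rule that[OF d])
        fix V :: "'a set" and W :: "'a \<Rightarrow> 'a \<Rightarrow> real"
        assume V: "finite V" "V \<noteq> {}"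
          and symW: "\<And>u v. u \<in> V \<Longrightarrow> v \<in> V \<Longrightarrow> W u v = W v u"
          and W: "\<And>u v. u \<in> V \<Longrightarrow> v \<in> V \<Longrightarrow> 0 \<le> W u v \<and> W u v \<le> 1"
          and box: "box_small V I (\<lambda>x. edge_prod E (\<lambda>_. W) x - p ^ card E) (min d2 (d1 / 2))"
        show "cut_small V (\<lambda>u v. W u v - p) \<eta>"
        proof (cases rule: rooted_density[OF E E0 V _ _ box])
          case (3 s)
          note s = this[folded P_def]
          define w where "w u v = P / max (s u v) P" for u v
          have w: "\<bar>w u v\<bar> \<le> 1" for u v
            using P unfolding w_def by (auto simp: field_simps max_def)
          have Ww: "cut_small V (\<lambda>u v. W u v - w u v) \<eta>1"
            unfolding w_def using s by (intro d2(2)[OF V W]) (auto intro: cut_small_mono)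
          have "box_small V I (\<lambda>x. edge_prod E (\<lambda>_. W) x - edge_prod E (\<lambda>_. w) x) (real (card E) * \<eta>1)"
            using W w by (intro counting_lemma[OF Ww V(1) E]) force+
          from box_small_add[OF box box_small_cmult[OF this, of "-1"]]
          have "box_small V I (\<lambda>x. edge_prod E (\<lambda>_. w) x - P) (min d2 (d1 / 2) + real (card E) * \<eta>1)"
            by (simp add: P_def)
          then have "box_small V I (\<lambda>x. edge_prod E (\<lambda>_. w) x - P) d1"
            by (rule box_small_mono) (use \<eta>1' in linarith)
          then have "cut_small V (\<lambda>u v. w u v - p) (\<eta> / 2)"
            unfolding w_def using s by (intro d1(2)[OF V]) auto
          from cut_small_add[OF Ww this] have "cut_small V (\<lambda>u v. W u v - p) (\<eta>1 + \<eta> / 2)" by simp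
          then show "cut_small V (\<lambda>u v. W u v - p) \<eta>"
            by (rule cut_small_mono) (simp add: \<eta>1_def)
        qed (use symW W in auto)
      qed
    qed
  qed
qed

section \<open>From sets of prescribed size to the box norm\<close>

text \<open>Deleting a smallest element does not lower the average; this is repeated until
  \<open>m\<close> elements are left. Cross-multiplication keeps the statement meaningful for empty
  sets.\<close>

lemma subset_above_average:
  fixes h :: "'a \<Rightarrow> real"
  assumes "finite S" "m \<le> card S"
  shows "\<exists>T\<subseteq>S. card T = m \<and> real m * sum h S \<le> real (card S) * sum h T"
  using assms
proof (induction "card S - m" arbitrary: S)
  case 0
  then show ?case by (intro exI[of _ S]) auto
next
  case (Suc d)
  then have "S \<noteq> {}" by auto
  obtain x where x: "x \<in> S" "\<And>y. y \<in> S \<Longrightarrow> h x \<le> h y"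
    using ex_min_if_finite[of "h ` S"] Suc.prems \<open>S \<noteq> {}\<close>
    by (metis arg_min_if_finite(1) arg_min_least)
  define S' where "S' = S - {x}"
  have S': "finite S'" "card S = Suc (card S')" "sum h S = h x + sum h S'"
    unfolding S'_def using Suc.prems(1) sum.remove[OF Suc.prems(1) x(1), of h]
      card_Suc_Diff1[OF Suc.prems(1) x(1)] by (simp_all only: finite_Diff)
  have "m \<le> card S'" "d = card S' - m" using Suc.hyps(2) S' by auto
  then obtain T where T: "T \<subseteq> S'" "card T = m" "real m * sum h S' \<le> real (card S') * sum h T"
    using Suc.hyps(1)[of S'] S' by auto
  have "real (card S') * h x \<le> sum h S'"
    using sum_bounded_below[of S' "h x" h] x by (auto simp: S'_def)
  then have 1: "real (card S') * sum h S \<le> real (card S) * sum h S'"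
    by (simp add: S' algebra_simps)
  have "real m * sum h S \<le> real (card S) * sum h T"
  proof (cases "card S' = 0")
    case True
    then show ?thesis using \<open>m \<le> card S'\<close> T finite_subset[OF T(1) S'(1)] by simp
  next
    case False
    have "real (card S') * (real m * sum h S) \<le> real m * (real (card S) * sum h S')"
      using mult_left_mono[OF 1, of "real m"] by (simp add: mult_ac)
    also have "\<dots> \<le> real (card S') * (real (card S) * sum h T)"
      using mult_left_mono[OF T(3), of "real (card S)"] by (simp add: mult_ac)
    finally show ?thesis using False by simp
  qed
  then show ?case using T S'_def by blast
qed

lemma sum_bound_by_subsets:
  fixes h :: "'a \<Rightarrow> real"
  assumes S: "finite S" "m \<le> card S" "0 < m"
    and T: "\<And>T. T \<subseteq> S \<Longrightarrow> card T = m \<Longrightarrow> \<bar>sum h T\<bar> \<le> \<epsilon>"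
  shows "\<bar>sum h S\<bar> \<le> real (card S) / real m * \<epsilon>"
proof -
  have *: "sum g S \<le> real (card S) / real m * \<epsilon>"
    if g: "\<And>T. T \<subseteq> S \<Longrightarrow> card T = m \<Longrightarrow> sum g T \<le> \<epsilon>" for g :: "'a \<Rightarrow> real"
  proof -
    obtain T where "T \<subseteq> S" "card T = m" "real m * sum g S \<le> real (card S) * sum g T"
      using subset_above_average[OF S(1,2), of g] by blast
    then have "real m * sum g S \<le> real (card S) * \<epsilon>"
      using g[of T] by (meson mult_left_mono of_nat_0_le_iff order_trans)
    then show ?thesis using S(3) by (simp add: field_simps)
  qed
  have "sum h S \<le> real (card S) / real m * \<epsilon>"
    by (rule *) (rule abs_le_D1[OF T])
  moreover have "sum (\<lambda>x. - h x) S \<le> real (card S) / real m * \<epsilon>"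
    by (rule *) (simp add: sum_negf abs_le_D2[OF T])
  ultimately show ?thesis by (simp add: sum_negf abs_le_iff)
qed

text \<open>Sums over sets of one size control all subset sums, and then the sum of absolute values
  by splitting according to sign. Both the sets of size \<open>m\<close> and their complements must
  be linear in \<open>N\<close>; this is where the upper bound on \<gamma> will enter.
  \<open>N\<close> may exceed \<open>card V\<close>, since disjointness will confine
  \<open>V\<close> to a part of the vertex set.\<close>

lemma sum_abs_bound_by_subsets:
  fixes h :: "'a \<Rightarrow> real" and N \<tau> \<epsilon> :: real
  assumes V: "finite V" "real (card V) \<le> N" and N: "N > 0" and \<tau>: "\<tau> > 0"
    and m: "\<tau> * N \<le> real m" "\<tau> * N \<le> real (card V) - real m"
    and T: "\<And>T. T \<subseteq> V \<Longrightarrow> card T = m \<Longrightarrow> \<bar>sum h T\<bar> \<le> \<epsilon>"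
  shows "(\<Sum>v\<in>V. \<bar>h v\<bar>) \<le> 8 / \<tau>\<^sup>2 * \<epsilon>"
proof -
  have tN: "0 < \<tau> * N" using N \<tau> by simp
  then have m0: "0 < m" "m < card V" using m by auto
  have "\<tau> * N \<le> 1 * N" using m V(2) m0 by linarith
  then have \<tau>1: "\<tau> \<le> 1" using N by simp
  obtain T0 where "T0 \<subseteq> V" "card T0 = m" using m0 by (meson less_imp_le obtain_subset_with_card_n)
  then have \<epsilon>: "\<epsilon> \<ge> 0" using T[of T0] by linarith
  have ratio: "real (card S) / real t * x \<le> x / \<tau>"
    if "S \<subseteq> V" "\<tau> * N \<le> real t" "0 \<le> x" for S t x
  proof -
    have "real (card S) \<le> N" using card_mono[OF V(1) that(1)] V(2) by linarith
    then have "\<tau> * real (card S) \<le> real t" using mult_left_mono[of "real (card S)" N \<tau>] that(2) \<tau> by linarith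
    moreover have "real t > 0" using that(2) tN by linarith
    ultimately have "real (card S) / real t \<le> 1 / \<tau>" using \<tau> by (simp add: field_simps)
    from mult_right_mono[OF this that(3)] show ?thesis by simp
  qed
  have "\<bar>sum h V\<bar> \<le> real (card V) / real m * \<epsilon>"
    using m0 by (intro sum_bound_by_subsets[OF V(1)] T) auto
  also have "\<dots> \<le> \<epsilon> / \<tau>" by (rule ratio) (use m \<epsilon> in auto)
  finally have hV: "\<bar>sum h V\<bar> \<le> \<epsilon> / \<tau>" .
  \<comment> \<open>A set of size \<open>t\<close> either has size \<open>m\<close> or is the
    complement of such a set. Moreover \<open>2 * t\<close> is at most \<open>card V\<close>, so
    every set or its complement has at least \<open>t\<close> elements, and averaging over subsets
    of size \<open>t\<close> applies to it.\<close>
  define t where "t = min m (card V - m)"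
  have t: "0 < t" "\<tau> * N \<le> real t" "t + t \<le> card V" "t \<le> card V"
    using m m0 by (auto simp: t_def min_def of_nat_diff)
  define \<epsilon>' where "\<epsilon>' = 2 * \<epsilon> / \<tau>"
  have \<epsilon>': "\<epsilon>' \<ge> 0" using \<epsilon> \<tau> by (simp add: \<epsilon>'_def)
  have \<epsilon>1: "\<epsilon> \<le> \<epsilon> / \<tau>" using \<tau> \<tau>1 \<epsilon> by (simp add: field_simps mult_left_le)
  have compl: "sum h V = sum h S + sum h (V - S)" if "S \<subseteq> V" for S
    using sum.subset_diff[OF that V(1), of h] by simp
  have cc: "card (V - S) = card V - card S" if "S \<subseteq> V" for S
    using that V(1) by (meson card_Diff_subset finite_subset)
  have small: "\<bar>sum h S\<bar> \<le> \<epsilon>'" if S: "S \<subseteq> V" "card S = t" for S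
  proof (cases "t = m")
    case True
    then show ?thesis using T[of S] S \<epsilon>1 \<epsilon> \<tau> by (simp add: \<epsilon>'_def)
  next
    case False
    then have "card S = card V - m" using S by (auto simp: t_def min_def split: if_splits)
    then have "\<bar>sum h (V - S)\<bar> \<le> \<epsilon>" using S m0 cc[OF S(1)] by (intro T) auto
    then show ?thesis using compl[OF S(1)] hV \<epsilon>1 by (simp add: \<epsilon>'_def)
  qed
  have large: "\<bar>sum h S\<bar> \<le> \<epsilon>' / \<tau>" if S: "S \<subseteq> V" "t \<le> card S" for S
  proof -
    have "\<bar>sum h S\<bar> \<le> real (card S) / real t * \<epsilon>'"
      using S t V(1) by (intro sum_bound_by_subsets small) (auto intro: finite_subset)
    also have "\<dots> \<le> \<epsilon>' / \<tau>" by (rule ratio[OF S(1) t(2) \<epsilon>'])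
    finally show ?thesis .
  qed
  have any: "\<bar>sum h S\<bar> \<le> 2 * \<epsilon>' / \<tau>" if S: "S \<subseteq> V" for S
  proof (cases "t \<le> card S")
    case True
    moreover have "0 \<le> \<epsilon>' / \<tau>" using \<epsilon>' \<tau> by simp
    ultimately show ?thesis using large[OF S] by simp
  next
    case False
    then have "\<bar>sum h (V - S)\<bar> \<le> \<epsilon>' / \<tau>" using t cc[OF S] by (intro large) auto
    then show ?thesis using large[of V] t compl[OF S] by simp
  qed
  have "(\<Sum>v\<in>V. \<bar>h v\<bar>) = (\<Sum>v\<in>{v\<in>V. 0 \<le> h v}. \<bar>h v\<bar>) + (\<Sum>v\<in>{v\<in>V. \<not> 0 \<le> h v}. \<bar>h v\<bar>)"
    using V(1) by (subst sum.union_disjoint[symmetric]) (auto intro: sum.cong)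
  also have "\<dots> = sum h {v\<in>V. 0 \<le> h v} - sum h {v\<in>V. \<not> 0 \<le> h v}"
    by (simp add: sum_negf[symmetric] flip: diff_conv_add_uminus)
  also have "\<dots> \<le> 2 * \<epsilon>' / \<tau> + 2 * \<epsilon>' / \<tau>"
    using any[of "{v\<in>V. 0 \<le> h v}"] any[of "{v\<in>V. \<not> 0 \<le> h v}"] by (simp add: abs_le_iff)
  also have "\<dots> = 8 / \<tau>\<^sup>2 * \<epsilon>" by (simp add: \<epsilon>'_def power2_eq_square)
  finally show ?thesis .
qed

text \<open>\<open>D\<close> tells whether the hypothesis is restricted to disjoint sets. In the coordinates of \<open>J\<close> the
  indicators of sets of size \<open>m\<close> are replaced by bounded functions supported on smaller sets.\<close>

lemma relax_size_constraint:
  fixes \<Phi> :: "('i \<Rightarrow> 'a) \<Rightarrow> real" and D :: bool and \<tau> \<epsilon> :: real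
  assumes V: "finite V" "V \<noteq> {}" and I: "finite I" and \<tau>: "\<tau> > 0"
    and m: "\<tau> * card V \<le> real m"
      "\<tau> * card V \<le> real (card V) - (if D then card I else 1) * real m"
    and H: "\<And>U. (\<And>i. i \<in> I \<Longrightarrow> U i \<subseteq> V \<and> card (U i) = m) \<Longrightarrow>
        (D \<longrightarrow> disjoint_family_on U I) \<Longrightarrow>
        \<bar>mean (I \<rightarrow>\<^sub>E V) (\<lambda>x. \<Phi> x * (\<Prod>i\<in>I. of_bool (x i \<in> U i)))\<bar> \<le> \<epsilon>"
    and J: "J \<subseteq> I"
    and U: "\<And>i. i \<in> I \<Longrightarrow> U i \<subseteq> V \<and> card (U i) \<le> m"
      "\<And>i v. i \<in> I \<Longrightarrow> v \<in> V \<Longrightarrow> \<bar>f i v\<bar> \<le> of_bool (v \<in> U i)"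
      "\<And>i. i \<in> I - J \<Longrightarrow> card (U i) = m"
      "\<And>i v. i \<in> I - J \<Longrightarrow> f i v = of_bool (v \<in> U i)"
      "D \<longrightarrow> disjoint_family_on U I"
  shows "\<bar>mean (I \<rightarrow>\<^sub>E V) (\<lambda>x. \<Phi> x * (\<Prod>i\<in>I. f i (x i)))\<bar> \<le> (8 / \<tau>\<^sup>2) ^ card J * \<epsilon>"
  using finite_subset[OF J I] J U
proof (induction J arbitrary: U f rule: finite_induct)
  case empty
  have "(\<Prod>i\<in>I. f i (x i)) = (\<Prod>i\<in>I. of_bool (x i \<in> U i))" for x
    using empty.prems by (intro prod.cong) auto
  then show ?case using H[of U] empty.prems by simp
next
  case (insert j J)
  have j: "j \<in> I" using insert.prems by auto
  let ?X = "I \<rightarrow>\<^sub>E V"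
  \<comment> \<open>The mean is linear in the test function at \<open>j\<close>; \<open>h v\<close>
    is its coefficient at the value \<open>v\<close>.\<close>
  define h where "h v = mean ?X (\<lambda>x. \<Phi> (x(j := v)) * (\<Prod>i\<in>I - {j}. f i (x i))) / card V" for v
  have lin: "mean ?X (\<lambda>x. \<Phi> x * (\<Prod>i\<in>I. (f(j := g)) i (x i))) = (\<Sum>v\<in>V. g v * h v)" for g
  proof -
    have "(\<Prod>i\<in>I. (f(j := g)) i ((x(j := v)) i)) = g v * (\<Prod>i\<in>I - {j}. f i (x i))" for x v
      using prod.remove[OF I j, of "\<lambda>i. (f(j := g)) i ((x(j := v)) i)"] by simp
    then have "mean ?X (\<lambda>x. \<Phi> x * (\<Prod>i\<in>I. (f(j := g)) i (x i))) =
        mean ?X (\<lambda>x. mean V (\<lambda>v. g v * (\<Phi> (x(j := v)) * (\<Prod>i\<in>I - {j}. f i (x i)))))"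
      by (subst mean_resample[OF V(1) j]) (simp add: mult_ac)
    also have "\<dots> = mean V (\<lambda>v. g v * mean ?X (\<lambda>x. \<Phi> (x(j := v)) * (\<Prod>i\<in>I - {j}. f i (x i))))"
      by (subst mean_swap) (simp add: mean_cmult)
    finally show ?thesis by (simp add: mean_def[of V] h_def sum_divide_distrib)
  qed
  \<comment> \<open>The values still available to coordinate \<open>j\<close>: in the disjoint
    version a new set \<open>T\<close> has to avoid the sets of all other coordinates. These have at
    most \<open>m\<close> elements each, so the size hypothesis leaves room for \<open>m\<close>
    elements and a margin of \<open>\<tau> * card V\<close>.\<close>
  define V' where "V' = (if D then V - (\<Union>i\<in>I - {j}. U i) else V)"
  have V': "V' \<subseteq> V" by (auto simp: V'_def)
  have "real (card V) - (if D then card I - 1 else 0) * real m \<le> real (card V')"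
  proof (cases D)
    case True
    have "card (\<Union>i\<in>I - {j}. U i) \<le> (\<Sum>i\<in>I - {j}. card (U i))"
      using I by (intro card_UN_le) auto
    also have "\<dots> \<le> card (I - {j}) * m"
      using insert.prems(2) by (intro order_trans[OF sum_bounded_above[of _ _ m]]) auto
    finally have "card (\<Union>i\<in>I - {j}. U i) \<le> (card I - 1) * m" using I j by simp
    moreover have "card V - card (\<Union>i\<in>I - {j}. U i) \<le> card V'"
      using True by (simp add: V'_def diff_card_le_card_Diff finite_subset[OF _ V(1)] insert.prems(2) UN_subset_iff)
    ultimately have "card V \<le> card V' + (card I - 1) * m" by linarith
    then have "real (card V) \<le> real (card V') + real (card I - 1) * real m"
      by (metis of_nat_add of_nat_le_iff of_nat_mult)
    then show ?thesis using True by simp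
  qed (simp add: V'_def)
  moreover have "card I \<ge> 1" using I j by (metis One_nat_def Suc_leI card_gt_0_iff empty_iff)
  ultimately have m': "\<tau> * card V \<le> real (card V') - real m"
    using m(2) by (auto simp: of_nat_diff algebra_simps split: if_splits)
  have K: "(\<Sum>v\<in>V'. \<bar>h v\<bar>) \<le> 8 / \<tau>\<^sup>2 * ((8 / \<tau>\<^sup>2) ^ card J * \<epsilon>)"
  proof (rule sum_abs_bound_by_subsets[OF finite_subset[OF V' V(1)] _ _ \<tau> m(1) m'])
    show "real (card V') \<le> real (card V)" using V' V(1) by (simp add: card_mono)
    show "0 < real (card V)" using V by (simp add: card_gt_0_iff)
    fix T assume T: "T \<subseteq> V'" "card T = m"
    \<comment> \<open>Putting the indicator of a set of size exactly \<open>m\<close> at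
      \<open>j\<close> moves \<open>j\<close> out of the exceptional coordinates, so the induction
      hypothesis for \<open>J\<close> applies.\<close>
    define g where "g v = (of_bool (v \<in> T) :: real)" for v
    have "\<bar>mean ?X (\<lambda>x. \<Phi> x * (\<Prod>i\<in>I. (f(j := g)) i (x i)))\<bar> \<le> (8 / \<tau>\<^sup>2) ^ card J * \<epsilon>"
    proof (rule insert.IH)
      show "J \<subseteq> I" using insert.prems by auto
      fix i assume "i \<in> I"
      show "(U(j := T)) i \<subseteq> V \<and> card ((U(j := T)) i) \<le> m"
        using T V' insert.prems(2)[OF \<open>i \<in> I\<close>] by auto
      fix v assume "v \<in> V"
      show "\<bar>(f(j := g)) i v\<bar> \<le> of_bool (v \<in> (U(j := T)) i)"
        using insert.prems(3)[OF \<open>i \<in> I\<close> \<open>v \<in> V\<close>] by (simp add: g_def)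
    next
      fix i assume "i \<in> I - J"
      then show "card ((U(j := T)) i) = m" using T insert.prems(4)[of i] by auto
      fix v show "(f(j := g)) i v = of_bool (v \<in> (U(j := T)) i)"
        using \<open>i \<in> I - J\<close> insert.prems(5)[of i] by (auto simp: g_def)
    next
      show "D \<longrightarrow> disjoint_family_on (U(j := T)) I"
      proof (intro impI)
        assume D
        then have "T \<inter> U i = {}" if "i \<in> I" "i \<noteq> j" for i using T(1) that by (auto simp: V'_def)
        moreover have "U i \<inter> U l = {}" if "i \<in> I" "l \<in> I" "i \<noteq> l" for i l
          using insert.prems(6) \<open>D\<close> that by (simp add: disjoint_family_on_def)
        ultimately show "disjoint_family_on (U(j := T)) I"
          unfolding disjoint_family_on_def by (auto simp: Int_commute)
      qed
    qed
    then have "\<bar>\<Sum>v\<in>V. g v * h v\<bar> \<le> (8 / \<tau>\<^sup>2) ^ card J * \<epsilon>" by (simp only: lin)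
    moreover have "(\<Sum>v\<in>V. g v * h v) = sum h T"
      using T V' V(1) by (intro sum.mono_neutral_cong_right) (auto simp: g_def)
    ultimately show "\<bar>sum h T\<bar> \<le> (8 / \<tau>\<^sup>2) ^ card J * \<epsilon>" by simp
  qed
  have "U j \<subseteq> V'"
    using insert.prems(2)[OF j] insert.prems(6) j unfolding disjoint_family_on_def V'_def by auto
  have "mean ?X (\<lambda>x. \<Phi> x * (\<Prod>i\<in>I. f i (x i))) = (\<Sum>v\<in>V. f j v * h v)"
    using lin[of "f j"] by simp
  also have "\<bar>\<dots>\<bar> \<le> (\<Sum>v\<in>V. \<bar>f j v * h v\<bar>)" by (rule sum_abs)
  also have "\<dots> = (\<Sum>v\<in>V'. \<bar>f j v * h v\<bar>)"
  proof (rule sum.mono_neutral_right[OF V(1) V'], rule ballI)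
    fix v assume "v \<in> V - V'"
    then have "v \<in> V" "v \<notin> U j" using \<open>U j \<subseteq> V'\<close> by auto
    then have "f j v = 0" using insert.prems(3)[OF j, of v] by simp
    then show "\<bar>f j v * h v\<bar> = 0" by simp
  qed
  also have "\<dots> \<le> (\<Sum>v\<in>V'. \<bar>h v\<bar>)"
  proof (rule sum_mono)
    fix v assume "v \<in> V'"
    then have "\<bar>f j v\<bar> \<le> 1"
      using V' by (intro order_trans[OF insert.prems(3)[OF j, of v]]) auto
    then show "\<bar>f j v * h v\<bar> \<le> \<bar>h v\<bar>" by (simp add: abs_mult mult_left_le_one_le)
  qed
  also note K
  finally show ?case using insert.hyps by (simp add: mult.assoc)
qed

section \<open>Reduction to disjoint supports\<close>

text \<open>Union bound over ordered pairs of distinct indices, each of which collides under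
  \<open>q\<close> with probability at most \<beta>. It serves twice: with a partition of
  \<open>V\<close> as \<open>q\<close>, and with the identity, to discard maps that are not
  injective.\<close>

lemma mean_not_inj:
  fixes \<beta> :: real and V :: "'a set" and I :: "'i set" and q :: "'a \<Rightarrow> 'b"
  assumes V: "finite V" "V \<noteq> {}" and I: "finite I"
    and q: "\<And>u. u \<in> V \<Longrightarrow> real (card {v\<in>V. q v = q u}) \<le> \<beta> * card V"
  shows "mean (I \<rightarrow>\<^sub>E V) (\<lambda>x. of_bool (\<not> inj_on (\<lambda>i. q (x i)) I)) \<le> (real (card I))\<^sup>2 * \<beta>"
proof -
  let ?X = "I \<rightarrow>\<^sub>E V"
  have N: "real (card V) > 0" using V by (simp add: card_gt_0_iff)
  obtain u where "u \<in> V" using V by blast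
  from q[OF this] have "0 \<le> \<beta> * card V" by (meson of_nat_0_le_iff order_trans)
  then have \<beta>: "\<beta> \<ge> 0" using N by (simp add: zero_le_mult_iff)
  have pair: "mean ?X (\<lambda>x. of_bool (q (x j) = q (x i))) \<le> \<beta>" if "i \<in> I" "j \<in> I" "i \<noteq> j" for i j
  proof -
    have "mean ?X (\<lambda>x. of_bool (q (x j) = q (x i))) = mean V (\<lambda>u. mean V (\<lambda>v. of_bool (q v = q u)))"
      by (rule mean_pair[OF V(1) I that])
    also have "\<dots> \<le> \<beta>"
    proof (rule mean_le_const[OF _ \<beta>])
      fix u assume "u \<in> V"
      have "(\<Sum>v\<in>V. of_bool (q v = q u)) = real (card {v\<in>V. q v = q u})"
        using V(1) by (simp add: of_bool_def sum.If_cases Int_def)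
      then show "mean V (\<lambda>v. of_bool (q v = q u)) \<le> \<beta>"
        using q[OF \<open>u \<in> V\<close>] N by (simp add: mean_def field_simps)
    qed
    finally show ?thesis .
  qed
  have "mean ?X (\<lambda>x. of_bool (\<not> inj_on (\<lambda>i. q (x i)) I)) \<le>
      mean ?X (\<lambda>x. \<Sum>i\<in>I. \<Sum>j\<in>I. if i = j then 0 else of_bool (q (x j) = q (x i)))"
  proof (rule mean_mono)
    fix x :: "'i \<Rightarrow> 'a"
    let ?g = "\<lambda>i j. if i = j then 0 else (of_bool (q (x j) = q (x i)) :: real)"
    show "of_bool (\<not> inj_on (\<lambda>i. q (x i)) I) \<le> (\<Sum>i\<in>I. \<Sum>j\<in>I. ?g i j)"
    proof (cases "inj_on (\<lambda>i. q (x i)) I")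
      case True
      then show ?thesis by (auto intro!: sum_nonneg)
    next
      case False
      then obtain i j where ij: "i \<in> I" "j \<in> I" "i \<noteq> j" "q (x j) = q (x i)"
        unfolding inj_on_def by metis
      have "1 = ?g i j" using ij by simp
      also have "\<dots> \<le> (\<Sum>j\<in>I. ?g i j)"
        using ij I by (intro member_le_sum[of j I "?g i"]) auto
      also have "\<dots> \<le> (\<Sum>i\<in>I. \<Sum>j\<in>I. ?g i j)"
        using ij I by (intro member_le_sum[of i I "\<lambda>i. \<Sum>j\<in>I. ?g i j"]) (auto intro!: sum_nonneg)
      finally show ?thesis using False by simp
    qed
  qed
  also have "\<dots> = (\<Sum>i\<in>I. \<Sum>j\<in>I. mean ?X (\<lambda>x. if i = j then 0 else of_bool (q (x j) = q (x i))))"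
    by (simp add: mean_sum)
  also have "\<dots> \<le> (\<Sum>i\<in>I. \<Sum>j\<in>I. \<beta>)"
  proof (intro sum_mono)
    fix i j assume "i \<in> I" "j \<in> I"
    then show "mean ?X (\<lambda>x. if i = j then 0 else of_bool (q (x j) = q (x i))) \<le> \<beta>"
      using pair[of i j] \<beta> by (cases "i = j") auto
  qed
  also have "\<dots> = (real (card I))\<^sup>2 * \<beta>" by (simp add: power2_eq_square)
  finally show ?thesis .
qed

text \<open>Vertices are numbered and coloured by residue modulo \<open>M\<close>; within a colour
  the quotients by \<open>M\<close> are distinct. They range from 0 up to and including
  \<open>card V div M\<close>, hence the extra 1.\<close>

lemma equipartition:
  assumes V: "finite V" and M: "M > 0"
  obtains q :: "'a \<Rightarrow> nat" where "\<And>v. v \<in> V \<Longrightarrow> q v < M" "\<And>a. real (card {v\<in>V. q v = a}) \<le> card V / M + 1"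
proof -
  obtain g where g: "bij_betw g V {0..<card V}" using ex_bij_betw_finite_nat[OF V] by blast
  have "card {v\<in>V. g v mod M = a} \<le> card {..card V div M}" for a
  proof (rule card_inj_on_le)
    show "inj_on (\<lambda>v. g v div M) {v\<in>V. g v mod M = a}"
    proof (rule inj_onI)
      fix v w assume vw: "v \<in> {v\<in>V. g v mod M = a}" "w \<in> {v\<in>V. g v mod M = a}" "g v div M = g w div M"
      then have "g v div M * M + g v mod M = g w div M * M + g w mod M" by simp
      then have "g v = g w" by (simp only: div_mult_mod_eq)
      then show "v = w" using g vw by (auto simp: bij_betw_def inj_on_def)
    qed
    show "(\<lambda>v. g v div M) ` {v\<in>V. g v mod M = a} \<subseteq> {..card V div M}"
    proof (rule image_subsetI)
      fix v assume "v \<in> {v\<in>V. g v mod M = a}"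
      then have "g v \<in> {0..<card V}" using bij_betwE[OF g] by blast
      then show "g v div M \<in> {..card V div M}" by (simp add: div_le_mono)
    qed
  qed simp
  then have c: "card {v\<in>V. g v mod M = a} \<le> card V div M + 1" for a by simp
  have "real (card {v\<in>V. g v mod M = a}) \<le> card V / M + 1" for a
  proof -
    have "real (card {v\<in>V. g v mod M = a}) \<le> real (card V div M) + 1"
      using c[of a] by linarith
    also have "real (card V div M) \<le> card V / M" by (rule of_nat_div_le_of_nat)
    finally show ?thesis by simp
  qed
  then show ?thesis using M by (intro that[of "\<lambda>v. g v mod M"]) auto
qed

text \<open>After cutting \<open>V\<close> into \<open>M\<close> parts of size at most \<open>m\<close>, all but a fraction \<open>O(1/M)\<close> of the maps
  \<open>I \<rightarrow> V\<close> send different indices to different parts, so disjoint supports suffice.\<close>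

lemma box_from_sets:
  fixes \<Phi> :: "('i \<Rightarrow> 'a) \<Rightarrow> real" and D :: bool and \<tau> \<epsilon> :: real and M :: nat
  assumes V: "finite V" "V \<noteq> {}" and I: "finite I" and \<tau>: "\<tau> > 0"
    and m: "\<tau> * card V \<le> real m"
      "\<tau> * card V \<le> real (card V) - (if D then card I else 1) * real m"
    and H: "\<And>U. (\<And>i. i \<in> I \<Longrightarrow> U i \<subseteq> V \<and> card (U i) = m) \<Longrightarrow>
        (D \<longrightarrow> disjoint_family_on U I) \<Longrightarrow>
        \<bar>mean (I \<rightarrow>\<^sub>E V) (\<lambda>x. \<Phi> x * (\<Prod>i\<in>I. of_bool (x i \<in> U i)))\<bar> \<le> \<epsilon>"
    and \<epsilon>: "\<epsilon> \<ge> 0"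
    and \<Phi>: "\<And>x. x \<in> (I \<rightarrow>\<^sub>E V) \<Longrightarrow> \<bar>\<Phi> x\<bar> \<le> 1"
    and M: "M > 0" "card V / M + 1 \<le> real m"
  shows "box_small V I \<Phi> (real M ^ card I * ((8 / \<tau>\<^sup>2) ^ card I * \<epsilon>) +
     (real (card I))\<^sup>2 * (1 / M + 1 / card V))"
proof (rule box_smallI)
  fix f :: "'i \<Rightarrow> 'a \<Rightarrow> real" assume f: "\<And>i v. i \<in> I \<Longrightarrow> v \<in> V \<Longrightarrow> \<bar>f i v\<bar> \<le> 1"
  let ?X = "I \<rightarrow>\<^sub>E V"
  have N: "real (card V) > 0" using V by (simp add: card_gt_0_iff)
  obtain q :: "'a \<Rightarrow> nat" where q: "\<And>v. v \<in> V \<Longrightarrow> q v < M" "\<And>a. real (card {v\<in>V. q v = a}) \<le> card V / M + 1"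
    using equipartition[OF V(1) M(1)] by blast
  let ?F = "\<lambda>x. \<Phi> x * (\<Prod>i\<in>I. f i (x i))"
  \<comment> \<open>The patterns in which different indices are sent to different parts. For
    \<open>a\<close> in \<open>A\<close> the functions \<open>g a i\<close> defined below have
    disjoint supports.\<close>
  define A where "A = {a \<in> I \<rightarrow>\<^sub>E {..<M}. inj_on a I}"
  have fA: "finite A" unfolding A_def
    by (rule finite_subset[OF _ finite_PiE[OF I, of "\<lambda>_. {..<M}"]]) auto
  have cA: "real (card A) \<le> real M ^ card I"
  proof -
    have "card A \<le> card (I \<rightarrow>\<^sub>E {..<M})" unfolding A_def using I by (intro card_mono) (auto intro: finite_PiE)
    then show ?thesis using I by (simp add: card_PiE flip: of_nat_power)
  qed
  define g where "g a i v = f i v * of_bool (q v = a i)" for a i v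
  \<comment> \<open>All coordinates are exceptional here (\<open>J = I\<close>), so parts of any
    size up to \<open>m\<close> are allowed.\<close>
  have 1: "\<bar>mean ?X (\<lambda>x. \<Phi> x * (\<Prod>i\<in>I. g a i (x i)))\<bar> \<le> (8 / \<tau>\<^sup>2) ^ card I * \<epsilon>" if a: "a \<in> A" for a
  proof (rule relax_size_constraint[OF V I \<tau> m H order_refl, where U = "\<lambda>i. {v\<in>V. q v = a i}"])
    fix i assume i: "i \<in> I"
    show "{v\<in>V. q v = a i} \<subseteq> V \<and> card {v\<in>V. q v = a i} \<le> m"
      using q(2)[of "a i"] M(2) by auto
    fix v assume "v \<in> V"
    then show "\<bar>g a i v\<bar> \<le> of_bool (v \<in> {v\<in>V. q v = a i})"
      using f[OF i] by (simp add: g_def abs_mult)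
  next
    show "D \<longrightarrow> disjoint_family_on (\<lambda>i. {v\<in>V. q v = a i}) I"
      using a unfolding A_def disjoint_family_on_def inj_on_def by auto
  qed auto
  \<comment> \<open>At \<open>x\<close> only its own pattern can contribute, and it belongs to
    \<open>A\<close> unless two indices share a part; the last term covers that case.\<close>
  have 2: "?F x = (\<Sum>a\<in>A. \<Phi> x * (\<Prod>i\<in>I. g a i (x i))) + ?F x * of_bool (\<not> inj_on (\<lambda>i. q (x i)) I)"
    if x: "x \<in> ?X" for x
  proof -
    define a0 where "a0 = restrict (\<lambda>i. q (x i)) I"
    have z: "(\<Prod>i\<in>I. g a i (x i)) = 0" if "a \<in> A" "a \<noteq> a0" for a
    proof -
      have "\<exists>i\<in>I. q (x i) \<noteq> a i"
        using that extensionalityI[of a I a0] unfolding A_def a0_def by (auto simp: PiE_iff)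
      then have "\<exists>i\<in>I. g a i (x i) = 0" by (auto simp: g_def)
      then show ?thesis by (rule prod_zero[OF I])
    qed
    show ?thesis
    proof (cases "inj_on (\<lambda>i. q (x i)) I")
      case True
      then have a0: "a0 \<in> A" using x q(1) unfolding A_def a0_def
        by (auto simp: PiE_iff inj_on_def)
      have "(\<Sum>a\<in>A. \<Phi> x * (\<Prod>i\<in>I. g a i (x i))) = (\<Sum>a\<in>{a0}. \<Phi> x * (\<Prod>i\<in>I. g a i (x i)))"
        using a0 z fA by (intro sum.mono_neutral_right) auto
      also have "\<dots> = ?F x" by (simp add: g_def a0_def)
      finally show ?thesis using True by simp
    next
      case False
      have "a0 \<notin> A" using False unfolding A_def a0_def by (auto simp: inj_on_def)
      then have "(\<Sum>a\<in>A. \<Phi> x * (\<Prod>i\<in>I. g a i (x i))) = 0" using z by (intro sum.neutral) auto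
      then show ?thesis using False by simp
    qed
  qed
  have "mean ?X ?F = (\<Sum>a\<in>A. mean ?X (\<lambda>x. \<Phi> x * (\<Prod>i\<in>I. g a i (x i)))) +
      mean ?X (\<lambda>x. ?F x * of_bool (\<not> inj_on (\<lambda>i. q (x i)) I))"
    using 2 by (simp add: mean_add[symmetric] mean_sum[symmetric] cong: mean_cong)
  moreover have "\<bar>\<Sum>a\<in>A. mean ?X (\<lambda>x. \<Phi> x * (\<Prod>i\<in>I. g a i (x i)))\<bar> \<le> real M ^ card I * ((8 / \<tau>\<^sup>2) ^ card I * \<epsilon>)"
  proof -
    have "\<bar>\<Sum>a\<in>A. mean ?X (\<lambda>x. \<Phi> x * (\<Prod>i\<in>I. g a i (x i)))\<bar> \<le> (\<Sum>a\<in>A. (8 / \<tau>\<^sup>2) ^ card I * \<epsilon>)"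
      using 1 by (intro order_trans[OF sum_abs] sum_mono)
    also have "\<dots> \<le> real M ^ card I * ((8 / \<tau>\<^sup>2) ^ card I * \<epsilon>)"
      using cA \<epsilon> by (simp add: mult_right_mono)
    finally show ?thesis .
  qed
  moreover have "\<bar>mean ?X (\<lambda>x. ?F x * of_bool (\<not> inj_on (\<lambda>i. q (x i)) I))\<bar> \<le> (real (card I))\<^sup>2 * (1 / M + 1 / card V)"
  proof -
    have "\<bar>mean ?X (\<lambda>x. ?F x * of_bool (\<not> inj_on (\<lambda>i. q (x i)) I))\<bar>
       \<le> mean ?X (\<lambda>x. of_bool (\<not> inj_on (\<lambda>i. q (x i)) I))"
    proof (rule order_trans[OF mean_abs], rule mean_mono)
      fix x assume x: "x \<in> ?X"
      then have "\<bar>\<Prod>i\<in>I. f i (x i)\<bar> \<le> 1" using f by (intro abs_prod_le_1) auto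
      then have "\<bar>?F x\<bar> \<le> 1" using \<Phi>[OF x] by (simp add: abs_mult mult_le_one)
      then show "\<bar>?F x * of_bool (\<not> inj_on (\<lambda>i. q (x i)) I)\<bar> \<le> of_bool (\<not> inj_on (\<lambda>i. q (x i)) I)"
        by (simp add: abs_mult)
    qed
    also have "\<dots> \<le> (real (card I))\<^sup>2 * (1 / M + 1 / card V)"
    proof (rule mean_not_inj[OF V I])
      fix u
      show "real (card {v\<in>V. q v = q u}) \<le> (1 / M + 1 / card V) * card V"
        using q(2)[of "q u"] N by (simp add: algebra_simps)
    qed
    finally show ?thesis .
  qed
  ultimately show "\<bar>mean ?X ?F\<bar> \<le> real M ^ card I * ((8 / \<tau>\<^sup>2) ^ card I * \<epsilon>) +
     (real (card I))\<^sup>2 * (1 / M + 1 / card V)" by linarith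
qed

section \<open>Counting homomorphisms\<close>

definition adj :: "'a graph \<Rightarrow> 'a \<Rightarrow> 'a \<Rightarrow> real" where
  "adj G u v = of_bool ({u, v} \<in> edges G)"

lemma adj_sym: "adj G u v = adj G v u"
  by (simp add: adj_def insert_commute)

lemma adj_bounds: "0 \<le> adj G u v" "adj G u v \<le> 1" "\<bar>adj G u v\<bar> \<le> 1"
  by (auto simp: adj_def)

lemma simple_graph_edge_set: "simple_graph F \<Longrightarrow> verts F = I \<Longrightarrow> edge_set I (edges F)"
  by (auto simp: simple_graph_def edge_set_def)

text \<open>Homomorphisms are defined through ordered pairs, the product through edges oriented from
  minimum to maximum; the two agree because the edges of \<open>G\<close> are unordered.\<close>

lemma edge_prod_adj:
  assumes "edge_set I E"
  shows "edge_prod E (\<lambda>_. adj G) x = of_bool (\<forall>a b. {a, b} \<in> E \<longrightarrow> {x a, x b} \<in> edges G)"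
proof -
  have fE: "finite E" by (rule edge_set_finite[OF assms])
  have "edge_prod E (\<lambda>_. adj G) x = of_bool (\<forall>e\<in>E. {x (Min e), x (Max e)} \<in> edges G)"
    unfolding edge_prod_def adj_def using fE by (induction E rule: finite_induct) auto
  moreover have "(\<forall>e\<in>E. {x (Min e), x (Max e)} \<in> edges G) \<longleftrightarrow>
      (\<forall>a b. {a, b} \<in> E \<longrightarrow> {x a, x b} \<in> edges G)" (is "?L \<longleftrightarrow> ?R")
  proof
    assume L: ?L
    show ?R
    proof (intro allI impI)
      fix a b assume "{a, b} \<in> E"
      then have "{x (min a b), x (max a b)} \<in> edges G" using L by force
      then show "{x a, x b} \<in> edges G" by (auto simp: min_def max_def insert_commute split: if_splits)
    qed
  next
    assume ?R
    then show ?L using edge_setD(4)[OF assms] by metis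
  qed
  ultimately show ?thesis by simp
qed

lemma prod_of_bool:
  "finite A \<Longrightarrow> (\<Prod>i\<in>A. of_bool (P i)) = (of_bool (\<forall>i\<in>A. P i) :: real)"
  by (induction A rule: finite_induct) auto

lemma num_inj_homs_in_conv_mean:
  fixes G :: "'a graph"
  assumes F: "simple_graph F" "verts F = {1..k}" and G: "finite (verts G)" "verts G \<noteq> {}"
  shows "real (num_inj_homs_in F G U) =
    mean ({1..k} \<rightarrow>\<^sub>E verts G) (\<lambda>x. edge_prod (edges F) (\<lambda>_. adj G) x *
       (\<Prod>i\<in>{1..k}. of_bool (x i \<in> U i)) * of_bool (inj_on x {1..k})) * real (card (verts G)) ^ k"
proof -
  let ?X = "{1..k} \<rightarrow>\<^sub>E verts G"
  have E: "edge_set {1..k} (edges F)" using F by (rule simple_graph_edge_set)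
  have X: "finite ?X" using G by (auto intro: finite_PiE)
  have cX: "real (card ?X) = real (card (verts G)) ^ k" by (simp add: card_PiE)
  have "real (num_inj_homs_in F G U) = (\<Sum>x\<in>?X. of_bool (x \<in> {\<phi> \<in> inj_homs F G. \<forall>i\<in>verts F. \<phi> i \<in> U i}))"
  proof -
    have "{\<phi> \<in> inj_homs F G. \<forall>i\<in>verts F. \<phi> i \<in> U i} = ?X \<inter> {\<phi> \<in> inj_homs F G. \<forall>i\<in>verts F. \<phi> i \<in> U i}"
      using F by (auto simp: inj_homs_def)
    then show ?thesis unfolding num_inj_homs_in_def using X by (simp add: Int_def)
  qed
  also have "\<dots> = (\<Sum>x\<in>?X. edge_prod (edges F) (\<lambda>_. adj G) x *
       (\<Prod>i\<in>{1..k}. of_bool (x i \<in> U i)) * of_bool (inj_on x {1..k}))"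
    using F by (intro sum.cong refl) (auto simp: edge_prod_adj[OF E] prod_of_bool inj_homs_def)
  finally show ?thesis using G cX by (simp add: mean_def)
qed

text \<open>Dropping injectivity costs at most the probability that two coordinates of a random map
  coincide. The counts thereby become means over all maps, to which the box norm applies.\<close>

lemma num_inj_homs_in_approx:
  fixes G :: "'a graph"
  assumes F: "simple_graph F" "verts F = {1..k}" and G: "finite (verts G)" "verts G \<noteq> {}"
  shows "\<bar>real (num_inj_homs_in F G U) / real (card (verts G)) ^ k -
    mean ({1..k} \<rightarrow>\<^sub>E verts G) (\<lambda>x. edge_prod (edges F) (\<lambda>_. adj G) x *
       (\<Prod>i\<in>{1..k}. of_bool (x i \<in> U i)))\<bar> \<le> (real k)\<^sup>2 / card (verts G)"
proof -
  let ?X = "{1..k} \<rightarrow>\<^sub>E verts G"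
  let ?f = "\<lambda>x. edge_prod (edges F) (\<lambda>_. adj G) x * (\<Prod>i\<in>{1..k}. of_bool (x i \<in> U i))"
  have E: "edge_set {1..k} (edges F)" using F by (rule simple_graph_edge_set)
  have "\<bar>mean ?X (\<lambda>x. ?f x * of_bool (inj_on x {1..k})) - mean ?X ?f\<bar>
      = \<bar>mean ?X (\<lambda>x. ?f x * of_bool (inj_on x {1..k}) - ?f x)\<bar>"
    by (simp add: mean_diff)
  also have "\<dots> \<le> mean ?X (\<lambda>x. \<bar>?f x * of_bool (inj_on x {1..k}) - ?f x\<bar>)"
    by (rule mean_abs)
  also have "\<dots> \<le> mean ?X (\<lambda>x. of_bool (\<not> inj_on (\<lambda>i. x i) {1..k}))"
    by (rule mean_mono) (auto simp: edge_prod_adj[OF E] prod_of_bool)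
  also have "\<dots> \<le> (real (card {1..k}))\<^sup>2 * (1 / card (verts G))"
  proof (rule mean_not_inj[OF G, of "{1..k}" "\<lambda>v. v"])
    fix u assume "u \<in> verts G"
    then have "{v \<in> verts G. v = u} = {u}" by auto
    then show "real (card {v \<in> verts G. v = u}) \<le> 1 / card (verts G) * card (verts G)"
      using G by simp
  qed simp
  finally show ?thesis
    using G unfolding num_inj_homs_in_conv_mean[OF F G] by simp
qed

lemma mean_prod_of_bool:
  assumes "finite V" "\<And>i. i \<in> {1..k} \<Longrightarrow> U i \<subseteq> V"
  shows "mean ({1..k} \<rightarrow>\<^sub>E V) (\<lambda>x. \<Prod>i\<in>{1..k}. of_bool (x i \<in> U i)) =
    (\<Prod>i\<in>{1..k}. real (card (U i))) / real (card V) ^ k"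
proof -
  have "(\<Sum>v\<in>V. of_bool (v \<in> U i)) = real (card (U i))" if "i \<in> {1..k}" for i
    using assms(1) assms(2)[OF that] by (simp add: Int_absorb1 Int_def[symmetric])
  then have "(\<Prod>i\<in>{1..k}. real (card (U i))) = (\<Prod>i\<in>{1..k}. \<Sum>v\<in>V. of_bool (v \<in> U i))"
    by simp
  also have "\<dots> = (\<Sum>x\<in>{1..k} \<rightarrow>\<^sub>E V. \<Prod>i\<in>{1..k}. of_bool (x i \<in> U i))"
    using assms(1) by (intro prod_sum_PiE) auto
  finally show ?thesis by (simp add: mean_def card_PiE)
qed

section \<open>Quasi-random sequences\<close>

definition cycle4 :: "nat set set" where
  "cycle4 = {{1, 2}, {2, 3}, {3, 4}, {1, 4}}"

lemma edge_set_cycle4: "edge_set {1..4} cycle4"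
  by (auto simp: edge_set_def cycle4_def)

lemma edge_prod_cycle4:
  "edge_prod cycle4 (\<lambda>_. K) x = K (x 1) (x 2) * K (x 2) (x 3) * K (x 3) (x 4) * K (x 1) (x 4)"
proof -
  have "{1, 2} \<notin> {{2, 3}, {3, 4}, {1, 4 :: nat}}" "{2, 3} \<notin> {{3, 4}, {1, 4 :: nat}}"
     "{3, 4} \<noteq> {1, 4 :: nat}"
    by (auto simp: doubleton_eq_iff)
  then show ?thesis unfolding edge_prod_def cycle4_def by (simp add: mult.assoc eval_nat_numeral)
qed

lemma mean_square_mean_swap:
  "mean V (\<lambda>u. (mean V (\<lambda>v. h u v))\<^sup>2) = mean V (\<lambda>y. mean V (\<lambda>z. mean V (\<lambda>u. h u y * h u z)))"
proof -
  have "mean V (\<lambda>u. (mean V (\<lambda>v. h u v))\<^sup>2) = mean V (\<lambda>u. mean V (\<lambda>y. mean V (\<lambda>z. h u y * h u z)))"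
    by (simp add: power2_eq_square mean_cmult mean_multc)
  also have "\<dots> = mean V (\<lambda>y. mean V (\<lambda>u. mean V (\<lambda>z. h u y * h u z)))" by (rule mean_swap)
  also have "\<dots> = mean V (\<lambda>y. mean V (\<lambda>z. mean V (\<lambda>u. h u y * h u z)))"
    by (rule mean_cong) (rule mean_swap)
  finally show ?thesis .
qed

text \<open>A first application of Cauchy-Schwarz removes \<open>f\<close> and a second one removes
  \<open>g\<close>. What remains is the mean square of the codegree kernel \<open>D\<close>, which
  is the 4-cycle density, so it bounds the fourth power of the tested mean.\<close>

lemma cut_from_cycle4:
  fixes K :: "'a \<Rightarrow> 'a \<Rightarrow> real"
  assumes V: "finite V" and sym: "\<And>u v. K u v = K v u"
    and c4: "mean ({1..4::nat} \<rightarrow>\<^sub>E V) (edge_prod cycle4 (\<lambda>_. K)) \<le> \<eta> ^ 4" and \<eta>: "\<eta> \<ge> 0"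
  shows "cut_small V K \<eta>"
proof (rule cut_smallI)
  fix f g :: "'a \<Rightarrow> real"
  assume f: "\<And>v. v \<in> V \<Longrightarrow> \<bar>f v\<bar> \<le> 1" and g: "\<And>v. v \<in> V \<Longrightarrow> \<bar>g v\<bar> \<le> 1"
  define D where "D y z = mean V (\<lambda>u. K u y * K u z)" for y z
  define T where "T = mean V (\<lambda>u. mean V (\<lambda>v. K u v * f u * g v))"
  \<comment> \<open>The opposite vertices 1 and 3 of the cycle have the same neighbours 2 and 4, so
    averaging over them yields two equal factors \<open>D (x 2) (x 4)\<close>.\<close>
  have "mean ({1..4::nat} \<rightarrow>\<^sub>E V) (edge_prod cycle4 (\<lambda>_. K)) =
     mean ({1..4::nat} \<rightarrow>\<^sub>E V) (\<lambda>x. (D (x 2) (x 4))\<^sup>2)"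
    by (subst mean_resample2[OF V, of 1 _ 3])
      (auto simp: edge_prod_cycle4 D_def power2_eq_square mean_multc[symmetric] mean_cmult[symmetric]
        sym[of "_ 2"] mult_ac)
  also have "\<dots> = mean V (\<lambda>y. mean V (\<lambda>z. (D y z)\<^sup>2))"
    by (rule mean_pair[OF V, of "{1..4::nat}" 2 4 "\<lambda>y z. (D y z)\<^sup>2"]) auto
  finally have D: "mean V (\<lambda>y. mean V (\<lambda>z. (D y z)\<^sup>2)) \<le> \<eta> ^ 4" using c4 by simp
  have "T\<^sup>2 = (mean V (\<lambda>u. f u * mean V (\<lambda>v. K u v * g v)))\<^sup>2"
    unfolding T_def by (simp add: mean_cmult[symmetric] mult_ac)
  also have "\<dots> \<le> mean V (\<lambda>u. (f u * mean V (\<lambda>v. K u v * g v))\<^sup>2)" by (rule mean_square_le)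
  also have "\<dots> \<le> mean V (\<lambda>u. (mean V (\<lambda>v. K u v * g v))\<^sup>2)"
  proof (rule mean_mono)
    fix u assume "u \<in> V"
    then have "(f u)\<^sup>2 \<le> 1" using f[of u] by (simp add: abs_square_le_1)
    then show "(f u * mean V (\<lambda>v. K u v * g v))\<^sup>2 \<le> (mean V (\<lambda>v. K u v * g v))\<^sup>2"
      by (simp add: power_mult_distrib mult_left_le_one_le)
  qed
  also have "\<dots> = mean V (\<lambda>y. mean V (\<lambda>z. D y z * g y * g z))"
  proof -
    have "mean V (\<lambda>u. K u y * g y * (K u z * g z)) = D y z * g y * g z" for y z
      unfolding D_def mean_multc[symmetric] by (rule mean_cong) simp
    then show ?thesis unfolding mean_square_mean_swap by simp
  qed
  finally have "(T\<^sup>2)\<^sup>2 \<le> (mean V (\<lambda>y. mean V (\<lambda>z. D y z * g y * g z)))\<^sup>2"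
    by (intro power_mono) auto
  also have "\<dots> \<le> mean V (\<lambda>y. (mean V (\<lambda>z. D y z * g y * g z))\<^sup>2)" by (rule mean_square_le)
  also have "\<dots> \<le> mean V (\<lambda>y. mean V (\<lambda>z. (D y z * g y * g z)\<^sup>2))"
    by (rule mean_mono) (rule mean_square_le)
  also have "\<dots> \<le> mean V (\<lambda>y. mean V (\<lambda>z. (D y z)\<^sup>2))"
  proof (intro mean_mono)
    fix y z assume "y \<in> V" "z \<in> V"
    then have "(g y)\<^sup>2 \<le> 1" "(g z)\<^sup>2 \<le> 1" using g by (auto simp: abs_square_le_1)
    then have "(g y)\<^sup>2 * (g z)\<^sup>2 \<le> 1" by (intro mult_le_one) auto
    then show "(D y z * g y * g z)\<^sup>2 \<le> (D y z)\<^sup>2"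
      by (simp add: power_mult_distrib mult.assoc mult_left_le)
  qed
  also note D
  finally have "\<bar>T\<bar> ^ 4 \<le> \<eta> ^ 4" by (simp flip: power_mult)
  then have "\<bar>T\<bar> \<le> \<eta>" using \<eta> by (rule power_le_imp_le_base[of _ 3, simplified])
  then show "\<bar>mean V (\<lambda>u. mean V (\<lambda>v. K u v * f u * g v))\<bar> \<le> \<eta>" by (simp add: T_def)
qed

section \<open>Passing between quasi-randomness and the cut norm\<close>

lemma num_inj_homs_conv_in: "num_inj_homs F G = num_inj_homs_in F G (\<lambda>_. verts G)"
  unfolding num_inj_homs_def num_inj_homs_in_def by (rule arg_cong[of _ _ card]) (auto simp: inj_homs_def)

lemma num_inj_homs_in_le:
  assumes "verts F = {1..k}" "finite (verts G)"
  shows "num_inj_homs_in F G U \<le> card (verts G) ^ k"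
proof -
  have "num_inj_homs_in F G U \<le> card ({1..k} \<rightarrow>\<^sub>E verts G)"
    unfolding num_inj_homs_in_def using assms by (intro card_mono finite_PiE) (auto simp: inj_homs_def)
  then show ?thesis by (simp add: card_PiE)
qed

lemma homs_mean_tendsto:
  fixes G :: "nat \<Rightarrow> 'a graph"
  assumes G: "\<And>n. simple_graph (G n)" and qr: "quasi_random p G"
    and F: "simple_graph F" "verts F = {1..k}"
  shows "(\<lambda>n. mean ({1..k} \<rightarrow>\<^sub>E verts (G n)) (edge_prod (edges F) (\<lambda>_. adj (G n))))
     \<longlonglongrightarrow> p ^ card (edges F)"
proof -
  define N where "N n = card (verts (G n))" for n
  have N: "filterlim N at_top sequentially" using qr by (simp add: quasi_random_def N_def[abs_def])
  then have N': "(\<lambda>n. (real k)\<^sup>2 / real (N n)) \<longlonglongrightarrow> 0"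
    by (intro real_tendsto_divide_at_top[OF tendsto_const])
      (auto intro: filterlim_compose[OF filterlim_real_sequentially])
  obtain d where d: "d \<longlonglongrightarrow> 0"
    "\<And>n. real (num_inj_homs F (G n)) = (p ^ card (edges F) + d n) * real (N n) ^ k"
    using qr F unfolding quasi_random_def N_def by blast
  let ?m = "\<lambda>n. mean ({1..k} \<rightarrow>\<^sub>E verts (G n)) (edge_prod (edges F) (\<lambda>_. adj (G n)))"
  have "eventually (\<lambda>n. norm (?m n - p ^ card (edges F)) \<le> \<bar>d n\<bar> + (real k)\<^sup>2 / N n) sequentially"
    using eventually_compose_filterlim[OF eventually_gt_at_top[of 0] N]
  proof eventually_elim
    case (elim n)
    have V: "finite (verts (G n))" "verts (G n) \<noteq> {}"
      using G[of n] elim by (auto simp: simple_graph_def N_def)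
    have "(\<Prod>i\<in>{1..k}. of_bool (x i \<in> verts (G n))) = (1::real)" if "x \<in> {1..k} \<rightarrow>\<^sub>E verts (G n)" for x
      using that by (intro prod.neutral) auto
    then have "mean ({1..k} \<rightarrow>\<^sub>E verts (G n)) (\<lambda>x. edge_prod (edges F) (\<lambda>_. adj (G n)) x *
       (\<Prod>i\<in>{1..k}. of_bool (x i \<in> verts (G n)))) = ?m n"
      by (intro mean_cong) simp
    then have "\<bar>real (num_inj_homs F (G n)) / real (N n) ^ k - ?m n\<bar> \<le> (real k)\<^sup>2 / N n"
      using num_inj_homs_in_approx[OF F V, of "\<lambda>_. verts (G n)"]
      by (simp add: num_inj_homs_conv_in N_def)
    then show ?case using elim by (simp add: d(2))
  qed
  then have "(\<lambda>n. ?m n - p ^ card (edges F)) \<longlonglongrightarrow> 0"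
    by (rule Lim_null_comparison) (use tendsto_add[OF tendsto_rabs_zero[OF d(1)] N'] in simp)
  then show ?thesis by (simp add: LIM_zero_iff)
qed

text \<open>Expanding the product of adjacency minus \<open>p\<close> over the cycle gives signed
  densities of its spanning subgraphs. Quasi-randomness sends each density to a power of
  \<open>p\<close>, so the limit is the expansion of a product of factors \<open>p - p\<close>,
  which is 0.\<close>

lemma quasi_random_imp_cut:
  fixes G :: "nat \<Rightarrow> 'a graph"
  assumes G: "\<And>n. simple_graph (G n)" and qr: "quasi_random p G" and \<eta>: "\<eta> > 0"
  shows "eventually (\<lambda>n. cut_small (verts (G n)) (\<lambda>u v. adj (G n) u v - p) \<eta>) sequentially"
proof -
  let ?X = "\<lambda>n. {1..4::nat} \<rightarrow>\<^sub>E verts (G n)"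
  let ?m = "\<lambda>n A. mean (?X n) (edge_prod A (\<lambda>_. adj (G n)))"
  have fin: "finite cycle4" by (simp add: cycle4_def)
  have lim: "(\<lambda>n. ?m n A) \<longlonglongrightarrow> p ^ card A" if "A \<subseteq> cycle4" for A
  proof -
    have "simple_graph ({1..4::nat}, A)"
      using that edge_set_cycle4 by (auto simp: simple_graph_def edge_set_def)
    from homs_mean_tendsto[OF G qr this] show ?thesis by simp
  qed
  have exp: "mean (?X n) (edge_prod cycle4 (\<lambda>_ u v. adj (G n) u v - p)) =
      (\<Sum>A\<in>Pow cycle4. ?m n A * (- p) ^ card (cycle4 - A))" for n
  proof -
    have "edge_prod cycle4 (\<lambda>_ u v. adj (G n) u v - p) =
       (\<lambda>x. \<Sum>A\<in>Pow cycle4. edge_prod A (\<lambda>_. adj (G n)) x * (- p) ^ card (cycle4 - A))"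
      unfolding edge_prod_def diff_conv_add_uminus by (subst prod_add[OF fin]) simp
    then show ?thesis by (simp add: mean_sum mean_multc)
  qed
  have "(\<lambda>n. \<Sum>A\<in>Pow cycle4. ?m n A * (- p) ^ card (cycle4 - A)) \<longlonglongrightarrow>
     (\<Sum>A\<in>Pow cycle4. p ^ card A * (- p) ^ card (cycle4 - A))"
    by (intro tendsto_sum tendsto_mult tendsto_const lim) auto
  also have "(\<Sum>A\<in>Pow cycle4. p ^ card A * (- p) ^ card (cycle4 - A)) = (\<Prod>e\<in>cycle4. p + - p)"
    by (subst prod_add[OF fin]) simp
  also have "\<dots> = 0" by (rule prod_zero[OF fin]) (auto simp: cycle4_def)
  finally have "(\<lambda>n. mean (?X n) (edge_prod cycle4 (\<lambda>_ u v. adj (G n) u v - p))) \<longlonglongrightarrow> 0"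
    by (simp only: exp)
  then have "eventually (\<lambda>n. mean (?X n) (edge_prod cycle4 (\<lambda>_ u v. adj (G n) u v - p)) < \<eta> ^ 4) sequentially"
    by (rule order_tendstoD) (use \<eta> in simp)
  then show ?thesis
  proof eventually_elim
    case (elim n)
    show ?case
    proof (rule cut_from_cycle4)
      show "finite (verts (G n))" using G[of n] by (simp add: simple_graph_def)
    qed (use elim \<eta> in \<open>auto simp: adj_sym\<close>)
  qed
qed

text \<open>The counting lemma compares adjacency with the constant kernel \<open>p\<close>, and
  indicators of the sets \<open>U i\<close> are tests for the box norm. Box smallness quantifies
  over all tests, so the estimate is uniform in \<open>U\<close>.\<close>

lemma cut_imp_counts:
  fixes G :: "nat \<Rightarrow> 'a graph"
  assumes G: "\<And>n. simple_graph (G n)" and N: "filterlim (\<lambda>n. card (verts (G n))) at_top sequentially"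
    and cut: "\<And>\<eta>. \<eta> > 0 \<Longrightarrow> eventually (\<lambda>n. cut_small (verts (G n)) (\<lambda>u v. adj (G n) u v - p) \<eta>) sequentially"
    and F: "simple_graph F" "verts F = {1..k}" and p: "0 \<le> p" "p \<le> 1" and \<eta>: "\<eta> > 0"
  shows "eventually (\<lambda>n. \<forall>U. (\<forall>i\<in>{1..k}. U i \<subseteq> verts (G n)) \<longrightarrow>
    \<bar>real (num_inj_homs_in F (G n) U) - p ^ card (edges F) * (\<Prod>i\<in>{1..k}. real (card (U i)))\<bar>
      \<le> \<eta> * real (card (verts (G n))) ^ k) sequentially"
proof -
  let ?e = "card (edges F)"
  \<comment> \<open>Half of \<eta> is for the counting lemma, the other half for maps that are not
    injective. Adding 1 avoids division by zero for a graph without edges.\<close>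
  define \<eta>' where "\<eta>' = \<eta> / 2 / (?e + 1)"
  have \<eta>': "\<eta>' > 0" using \<eta> by (simp add: \<eta>'_def)
  have "real ?e * \<eta>' \<le> real (?e + 1) * \<eta>'" using \<eta>' by (intro mult_right_mono) auto
  also have "\<dots> = \<eta> / 2" by (simp add: \<eta>'_def del: of_nat_add of_nat_Suc)
  finally have e\<eta>': "real ?e * \<eta>' \<le> \<eta> / 2" .
  have E: "edge_set {1..k} (edges F)" using F by (rule simple_graph_edge_set)
  have "(\<lambda>n. (real k)\<^sup>2 / real (card (verts (G n)))) \<longlonglongrightarrow> 0"
    by (intro real_tendsto_divide_at_top[OF tendsto_const])
      (auto intro: filterlim_compose[OF filterlim_real_sequentially N])
  then have "eventually (\<lambda>n. (real k)\<^sup>2 / real (card (verts (G n))) < \<eta> / 2) sequentially"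
    by (rule order_tendstoD) (use \<eta> in simp)
  moreover have "eventually (\<lambda>n. 0 < card (verts (G n))) sequentially"
    by (rule eventually_compose_filterlim[OF eventually_gt_at_top N])
  ultimately show ?thesis using cut[OF \<eta>']
  proof eventually_elim
    case (elim n)
    let ?V = "verts (G n)"
    have V: "finite ?V" "?V \<noteq> {}" using elim by (auto simp: card_gt_0_iff)
    have "box_small ?V {1..k} (\<lambda>x. edge_prod (edges F) (\<lambda>_. adj (G n)) x - edge_prod (edges F) (\<lambda>_ _ _. p) x)
        (real ?e * \<eta>')"
      by (intro counting_lemma[OF elim(3) V(1) E]) (use p in \<open>simp_all add: adj_bounds\<close>)
    then have box: "box_small ?V {1..k} (\<lambda>x. edge_prod (edges F) (\<lambda>_. adj (G n)) x - p ^ ?e) (\<eta> / 2)"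
      using e\<eta>' by (auto simp: edge_prod_def intro: box_small_mono)
    show ?case
    proof (intro allI impI)
      fix U :: "nat \<Rightarrow> 'a set" assume U: "\<forall>i\<in>{1..k}. U i \<subseteq> ?V"
      let ?I = "\<lambda>x. \<Prod>i\<in>{1..k}. of_bool (x i \<in> U i) :: real"
      let ?N = "real (card ?V)" and ?R = "p ^ ?e * (\<Prod>i\<in>{1..k}. real (card (U i)))"
      have "\<bar>mean ({1..k} \<rightarrow>\<^sub>E ?V) (\<lambda>x. (edge_prod (edges F) (\<lambda>_. adj (G n)) x - p ^ ?e) * ?I x)\<bar> \<le> \<eta> / 2"
        using box_smallD[OF box, of "\<lambda>i v. of_bool (v \<in> U i)"] by simp
      moreover have "mean ({1..k} \<rightarrow>\<^sub>E ?V) (\<lambda>x. (edge_prod (edges F) (\<lambda>_. adj (G n)) x - p ^ ?e) * ?I x) =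
          mean ({1..k} \<rightarrow>\<^sub>E ?V) (\<lambda>x. edge_prod (edges F) (\<lambda>_. adj (G n)) x * ?I x) - ?R / ?N ^ k"
        using U mean_prod_of_bool[OF V(1), of k U]
        by (simp add: left_diff_distrib mean_diff mean_cmult)
      ultimately have "\<bar>real (num_inj_homs_in F (G n) U) / ?N ^ k - ?R / ?N ^ k\<bar> \<le> \<eta>"
        using num_inj_homs_in_approx[OF F V, of U] elim(1) by linarith
      then have "\<bar>real (num_inj_homs_in F (G n) U) - ?R\<bar> / ?N ^ k \<le> \<eta>"
        using V by (simp flip: diff_divide_distrib)
      then show "\<bar>real (num_inj_homs_in F (G n) U) - ?R\<bar> \<le> \<eta> * ?N ^ k"
        using V elim(2) by (simp add: divide_le_eq)
    qed
  qed
qed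

lemma cut_imp_quasi_random:
  fixes G :: "nat \<Rightarrow> 'a graph"
  assumes G: "\<And>n. simple_graph (G n)" and N: "filterlim (\<lambda>n. card (verts (G n))) at_top sequentially"
    and cut: "\<And>\<eta>. \<eta> > 0 \<Longrightarrow> eventually (\<lambda>n. cut_small (verts (G n)) (\<lambda>u v. adj (G n) u v - p) \<eta>) sequentially"
    and p: "0 \<le> p" "p \<le> 1"
  shows "quasi_random p G"
  unfolding quasi_random_def
proof (intro conjI N allI impI, elim conjE)
  fix k and F :: "nat graph" assume F: "simple_graph F" "verts F = {1..k}"
  let ?N = "\<lambda>n. real (card (verts (G n)))"
  define d where "d n = real (num_inj_homs F (G n)) / ?N n ^ k - p ^ card (edges F)" for n
  have "real (num_inj_homs F (G n)) = (p ^ card (edges F) + d n) * ?N n ^ k" for n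
  proof (cases "?N n ^ k = 0")
    \<comment> \<open>Where division by \<open>?N n ^ k\<close> is impossible, the trivial bound on
      the count makes both sides 0.\<close>
    case True
    have "finite (verts (G n))" using G[of n] by (simp add: simple_graph_def)
    then have "num_inj_homs F (G n) \<le> card (verts (G n)) ^ k"
      unfolding num_inj_homs_conv_in by (rule num_inj_homs_in_le[OF F(2)])
    then show ?thesis using True by (auto simp: power_0_left)
  qed (simp add: d_def)
  moreover have "d \<longlonglongrightarrow> 0"
  proof (rule LIMSEQ_I)
    fix r :: real assume "r > 0"
    then have r: "r / 2 > 0" by simp
    have "eventually (\<lambda>n. 0 < card (verts (G n))) sequentially"
      by (rule eventually_compose_filterlim[OF eventually_gt_at_top N])
    moreover have "eventually (\<lambda>n. \<forall>U. (\<forall>i\<in>{1..k}. U i \<subseteq> verts (G n)) \<longrightarrow>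
        \<bar>real (num_inj_homs_in F (G n) U) - p ^ card (edges F) * (\<Prod>i\<in>{1..k}. real (card (U i)))\<bar>
          \<le> r / 2 * ?N n ^ k) sequentially"
      by (rule cut_imp_counts[OF G N cut F p r])
    ultimately have "eventually (\<lambda>n. norm (d n - 0) < r) sequentially"
    proof eventually_elim
      case (elim n)
      have "\<bar>real (num_inj_homs F (G n)) - p ^ card (edges F) * ?N n ^ k\<bar> \<le> r / 2 * ?N n ^ k"
        using elim(2)[rule_format, of "\<lambda>_. verts (G n)"] by (simp add: num_inj_homs_conv_in)
      moreover have "real (num_inj_homs F (G n)) - p ^ card (edges F) * ?N n ^ k = d n * ?N n ^ k"
        using elim(1) by (simp add: d_def left_diff_distrib)
      ultimately have "\<bar>d n\<bar> \<le> r / 2" using elim(1) by (simp add: abs_mult)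
      then show ?case using \<open>r > 0\<close> by simp
    qed
    then show "\<exists>m. \<forall>n\<ge>m. norm (d n - 0) < r" by (simp add: eventually_sequentially)
  qed
  ultimately show "\<exists>d. d \<longlonglongrightarrow> 0 \<and> (\<forall>n. real (num_inj_homs F (G n)) = (p ^ card (edges F) + d n) * ?N n ^ k)"
    by blast
qed

section \<open>Restricted counts and the equivalence\<close>

text \<open>The theorem asks for one null sequence valid for every \<open>n\<close>, while limits
  only give, for each \<eta>, an estimate for large \<open>n\<close>. The best constant for each
  \<open>n\<close>, an infimum, has both properties; the trivial bound makes 1 admissible, so the
  infimum is over a nonempty set.\<close>

lemma vanishing_error_sequence:
  fixes f :: "nat \<Rightarrow> 'u \<Rightarrow> real" and b :: "nat \<Rightarrow> real"
  assumes small: "\<And>\<eta>. \<eta> > 0 \<Longrightarrow> eventually (\<lambda>n. \<forall>u. A n u \<longrightarrow> f n u \<le> \<eta> * b n) sequentially"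
    and bound: "\<And>n u. A n u \<Longrightarrow> f n u \<le> b n" and b: "\<And>n. b n \<ge> 0"
  shows "\<exists>\<epsilon>. \<epsilon> \<longlonglongrightarrow> 0 \<and> (\<forall>n u. A n u \<longrightarrow> f n u \<le> \<epsilon> n * b n)"
proof -
  define S where "S n = {e. 0 \<le> e \<and> (\<forall>u. A n u \<longrightarrow> f n u \<le> e * b n)}" for n
  define \<epsilon> where "\<epsilon> n = Inf (S n)" for n
  have ne: "S n \<noteq> {}" for n
    using bound[of n] by (auto simp: S_def intro!: exI[of _ 1])
  have bdd: "bdd_below (S n)" for n by (auto simp: S_def bdd_below_def)
  have \<epsilon>0: "0 \<le> \<epsilon> n" for n unfolding \<epsilon>_def using ne by (intro cInf_greatest) (auto simp: S_def)
  have "\<epsilon> \<longlonglongrightarrow> 0"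
  proof (rule LIMSEQ_I)
    fix r :: real assume "r > 0"
    then have r: "r / 2 > 0" by simp
    have "eventually (\<lambda>n. norm (\<epsilon> n - 0) < r) sequentially"
      using small[OF r]
    proof eventually_elim
      case (elim n)
      then have "r / 2 \<in> S n" using r by (simp add: S_def)
      then have "\<epsilon> n \<le> r / 2" unfolding \<epsilon>_def by (rule cInf_lower[OF _ bdd])
      then show ?case using \<epsilon>0[of n] \<open>r > 0\<close> by simp
    qed
    then show "\<exists>m. \<forall>n\<ge>m. norm (\<epsilon> n - 0) < r" by (simp add: eventually_sequentially)
  qed
  moreover have "f n u \<le> \<epsilon> n * b n" if u: "A n u" for n u
  proof (cases "b n = 0")
    case True
    then show ?thesis using bound[OF u] by simp
  next
    case False
    then have bn: "b n > 0" using b[of n] by simp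
    have "f n u / b n \<le> \<epsilon> n" unfolding \<epsilon>_def
      using u bn ne by (intro cInf_greatest) (auto simp: S_def divide_le_eq)
    then show ?thesis using bn by (simp add: divide_le_eq)
  qed
  ultimately show ?thesis by blast
qed

text \<open>Restricted counts are means over all maps up to an error of \<open>k\<^sup>2\<close>
  divided by the order of the graph; then \<open>box_from_sets\<close> and
  \<open>cut_from_box\<close> apply. The flag \<open>D\<close> covers both converse statements of
  the theorem at once.\<close>

lemma counts_imp_cut:
  fixes G :: "nat \<Rightarrow> 'a graph" and F :: "nat graph" and D :: bool
  assumes G: "\<And>n. simple_graph (G n)" and N: "filterlim (\<lambda>n. card (verts (G n))) at_top sequentially"
    and F: "simple_graph F" "verts F = {1..k}" "card (edges F) > 0"
    and p: "0 < p" "p \<le> 1" and \<gamma>: "0 < \<gamma>" "\<gamma> < 1" "D \<Longrightarrow> \<gamma> < 1 / real k"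
    and \<epsilon>: "\<epsilon> \<longlonglongrightarrow> 0"
    and H: "\<And>n U. (\<And>i. i \<in> {1..k} \<Longrightarrow> U i \<subseteq> verts (G n) \<and>
             int (card (U i)) = \<lfloor>\<gamma> * real (card (verts (G n)))\<rfloor>) \<Longrightarrow>
          (D \<longrightarrow> disjoint_family_on U {1..k}) \<Longrightarrow>
          \<bar>real (num_inj_homs_in F (G n) U)
             - p ^ card (edges F) * (\<Prod>i\<in>{1..k}. real (card (U i)))\<bar>
          \<le> \<epsilon> n * real (card (verts (G n))) ^ k"
    and \<eta>: "\<eta> > 0"
  shows "eventually (\<lambda>n. cut_small (verts (G n)) (\<lambda>u v. adj (G n) u v - p) \<eta>) sequentially"
proof -
  let ?e = "card (edges F)" and ?N = "\<lambda>n. real (card (verts (G n)))"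
  have E: "edge_set {1..k} (edges F)" using F by (intro simple_graph_edge_set)
  have E0: "edges F \<noteq> {}" using F by auto
  then have k: "k \<ge> 1" using edge_setD(1)[OF E] by fastforce
  define c where "c = (if D then k else 1)"
  have c: "c \<ge> 1" "\<gamma> * real c < 1" using \<gamma> k by (auto simp: c_def field_simps)
  \<comment> \<open>Half of \<gamma> is a lower bound for the relative size of the sets despite
    rounding, once the graph is large. The other term bounds the proportion that \<open>c\<close>
    such sets leave free: one set in general, \<open>k\<close> sets in the disjoint version, which
    is where \<open>\<gamma> < 1 / real k\<close> enters.\<close>
  define \<tau> where "\<tau> = min (\<gamma> / 2) (1 - \<gamma> * real c)"
  have \<tau>: "\<tau> > 0" "\<tau> \<le> \<gamma> / 2" "\<tau> \<le> 1 - \<gamma> * real c" using \<gamma> c by (auto simp: \<tau>_def min_def)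
  show ?thesis
  proof (cases rule: cut_from_box[where ?'a = 'a, OF E E0 p \<eta>])
    case (1 \<delta>)
    \<comment> \<open>The first bound lets the parts, of size at most \<open>?N n / M + 1\<close>,
      fit into sets of the prescribed size; the second makes \<open>k\<^sup>2 / M\<close> at most
      \<open>\<delta> / 4\<close>.\<close>
    define M where "M = nat \<lceil>max (4 / \<gamma>) (4 * (real k)\<^sup>2 / \<delta>)\<rceil>"
    have "max (4 / \<gamma>) (4 * (real k)\<^sup>2 / \<delta>) \<le> real M" unfolding M_def by linarith
    then have M: "4 / \<gamma> \<le> real M" "4 * (real k)\<^sup>2 / \<delta> \<le> real M" by auto
    have M0: "real M > 0" using M(1) \<gamma> by (meson divide_pos_pos less_le_trans zero_less_numeral)
    have kM: "(real k)\<^sup>2 / real M < \<delta>"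
    proof -
      have "4 * (real k)\<^sup>2 \<le> real M * \<delta>" using M(2) 1(1) by (simp add: pos_divide_le_eq)
      moreover have "(real k)\<^sup>2 > 0" using k by simp
      ultimately have "(real k)\<^sup>2 < \<delta> * real M" unfolding mult.commute[of \<delta>] by linarith
      then show ?thesis using M0 by (simp add: pos_divide_less_eq)
    qed
    \<comment> \<open>With \<open>M\<close> and \<tau> fixed this tends to
      \<open>k\<^sup>2 / M\<close>, which is below \<delta>. The absolute value supplies the
      nonnegative bound that \<open>box_from_sets\<close> requires, as nothing is assumed about the
      sign of \<epsilon>.\<close>
    let ?err = "\<lambda>n. real M ^ k * ((8 / \<tau>\<^sup>2) ^ k * (\<bar>\<epsilon> n\<bar> + (real k)\<^sup>2 / ?N n)) + (real k)\<^sup>2 * (1 / real M + 1 / ?N n)"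
    have N': "filterlim ?N at_top sequentially"
      by (rule filterlim_compose[OF filterlim_real_sequentially N])
    have lim0: "(\<lambda>n. x / ?N n) \<longlonglongrightarrow> 0" for x :: real
      by (intro real_tendsto_divide_at_top[OF tendsto_const] N')
    have "?err \<longlonglongrightarrow> real M ^ k * ((8 / \<tau>\<^sup>2) ^ k * (\<bar>0\<bar> + 0)) + (real k)\<^sup>2 * (1 / real M + 0)"
      by (intro tendsto_intros lim0 \<epsilon>)
    then have "eventually (\<lambda>n. ?err n < \<delta>) sequentially"
      by (rule order_tendstoD) (use kM in simp)
    moreover have "eventually (\<lambda>n. 4 / \<gamma> < ?N n) sequentially"
      using N' by (simp add: filterlim_at_top_dense)
    ultimately show ?thesis
    proof eventually_elim
      case (elim n)
      let ?V = "verts (G n)" and ?X = "{1..k} \<rightarrow>\<^sub>E verts (G n)"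
      let ?\<Phi> = "\<lambda>x. edge_prod (edges F) (\<lambda>_. adj (G n)) x - p ^ ?e"
      have Npos: "?N n > 0" using elim(2) \<gamma> by (meson divide_pos_pos less_trans zero_less_numeral)
      then have V: "finite ?V" "?V \<noteq> {}" by (auto simp: card_gt_0_iff)
      have gN: "\<gamma> * ?N n > 4" using elim(2) \<gamma> by (simp add: field_simps)
      define m where "m = nat \<lfloor>\<gamma> * ?N n\<rfloor>"
      have im: "int m = \<lfloor>\<gamma> * ?N n\<rfloor>" unfolding m_def using gN by simp
      then have m: "real m \<le> \<gamma> * ?N n" "\<gamma> * ?N n - 1 \<le> real m" by linarith+
      have m1: "\<tau> * ?N n \<le> real m"
        using mult_right_mono[OF \<tau>(2), of "?N n"] m gN by simp
      have "real c * real m \<le> real c * (\<gamma> * ?N n)" using m by (intro mult_left_mono) auto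
      then have m2: "\<tau> * ?N n \<le> ?N n - real c * real m"
        using mult_right_mono[OF \<tau>(3), of "?N n"] by (simp add: algebra_simps)
      have "1 / real M \<le> \<gamma> / 4" using M(1) M0 \<gamma> by (simp add: field_simps)
      from mult_right_mono[OF this, of "?N n"]
      have "?N n / real M \<le> \<gamma> * ?N n / 4" by simp
      then have m3: "?N n / real M + 1 \<le> real m" using m gN by linarith
      have box: "box_small ?V {1..k} ?\<Phi> (real M ^ card {1..k} * ((8 / \<tau>\<^sup>2) ^ card {1..k} * (\<bar>\<epsilon> n\<bar> + (real k)\<^sup>2 / ?N n)) +
          (real (card {1..k}))\<^sup>2 * (1 / real M + 1 / ?N n))"
      proof (rule box_from_sets[OF V _ \<tau>(1) m1, where D = D])
        show "\<tau> * ?N n \<le> ?N n - real (if D then card {1..k} else 1) * real m"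
          using m2 by (cases D) (simp_all add: c_def)
        show "0 \<le> \<bar>\<epsilon> n\<bar> + (real k)\<^sup>2 / ?N n" by simp
        show "0 < M" using M0 by simp
        show "?N n / real M + 1 \<le> real m" by (rule m3)
      next
        fix x assume "x \<in> ?X"
        then have "0 \<le> edge_prod (edges F) (\<lambda>_. adj (G n)) x" "edge_prod (edges F) (\<lambda>_. adj (G n)) x \<le> 1"
          using edge_prod_nonneg_le_1[OF E] adj_bounds by metis+
        moreover have "0 \<le> p ^ ?e" "p ^ ?e \<le> 1" using p by (auto simp: power_le_one)
        ultimately show "\<bar>?\<Phi> x\<bar> \<le> 1" by linarith
      next
        fix U :: "nat \<Rightarrow> 'a set"
        assume U: "\<And>i. i \<in> {1..k} \<Longrightarrow> U i \<subseteq> ?V \<and> card (U i) = m"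
          and dis: "D \<longrightarrow> disjoint_family_on U {1..k}"
        let ?I = "\<lambda>x. \<Prod>i\<in>{1..k}. of_bool (x i \<in> U i) :: real"
        let ?R = "p ^ ?e * (\<Prod>i\<in>{1..k}. real (card (U i)))"
        have "\<bar>real (num_inj_homs_in F (G n) U) - ?R\<bar> \<le> \<epsilon> n * ?N n ^ k"
          using U dis im by (intro H) auto
        then have "\<bar>real (num_inj_homs_in F (G n) U) - ?R\<bar> / ?N n ^ k \<le> \<epsilon> n"
          using Npos by (simp add: divide_le_eq)
        then have 1: "\<bar>real (num_inj_homs_in F (G n) U) / ?N n ^ k - ?R / ?N n ^ k\<bar> \<le> \<epsilon> n"
          by (simp flip: diff_divide_distrib)
        have "mean ?X (\<lambda>x. ?\<Phi> x * ?I x) =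
            mean ?X (\<lambda>x. edge_prod (edges F) (\<lambda>_. adj (G n)) x * ?I x) - ?R / ?N n ^ k"
          using U mean_prod_of_bool[OF V(1), of k U]
          by (simp add: left_diff_distrib mean_diff mean_cmult)
        then show "\<bar>mean ?X (\<lambda>x. ?\<Phi> x * ?I x)\<bar> \<le> \<bar>\<epsilon> n\<bar> + (real k)\<^sup>2 / ?N n"
          using num_inj_homs_in_approx[OF F(1,2) V, of U] 1 by linarith
      qed simp
      show ?case
      proof (rule 1(2)[OF V])
        show "box_small ?V {1..k} ?\<Phi> \<delta>"
          using box elim(1) by (auto intro: box_small_mono)
      qed (auto simp: adj_sym adj_bounds)
    qed
  qed
qed

theorem theorem3p6:
  fixes G :: "nat \<Rightarrow> 'a graph" and F :: "nat graph" and k :: nat and p \<gamma> :: real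
  assumes "\<And>n. simple_graph (G n)"
    and "filterlim (\<lambda>n. card (verts (G n))) at_top sequentially"
    and "simple_graph F" and "verts F = {1..k}" and "card (edges F) > 0"
    and "0 < p" and "p \<le> 1"
    and "0 < \<gamma>" and "\<gamma> < 1"
  shows "(quasi_random p G \<longleftrightarrow>
      (\<exists>\<epsilon> :: nat \<Rightarrow> real. \<epsilon> \<longlonglongrightarrow> 0 \<and>
        (\<forall>n. \<forall>U :: nat \<Rightarrow> 'a set.
          (\<forall>i\<in>{1..k}. U i \<subseteq> verts (G n) \<and>
             int (card (U i)) = \<lfloor>\<gamma> * real (card (verts (G n)))\<rfloor>) \<longrightarrow>
          \<bar>real (num_inj_homs_in F (G n) U)
             - p ^ card (edges F) * (\<Prod>i\<in>{1..k}. real (card (U i)))\<bar>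
          \<le> \<epsilon> n * real (card (verts (G n))) ^ k))) \<and>
    (\<gamma> < 1 / real k \<longrightarrow>
      (\<exists>\<epsilon> :: nat \<Rightarrow> real. \<epsilon> \<longlonglongrightarrow> 0 \<and>
        (\<forall>n. \<forall>U :: nat \<Rightarrow> 'a set.
          (\<forall>i\<in>{1..k}. U i \<subseteq> verts (G n) \<and>
             int (card (U i)) = \<lfloor>\<gamma> * real (card (verts (G n)))\<rfloor>) \<and>
          (\<forall>i\<in>{1..k}. \<forall>j\<in>{1..k}. i \<noteq> j \<longrightarrow> U i \<inter> U j = {}) \<longrightarrow>
          \<bar>real (num_inj_homs_in F (G n) U)
             - p ^ card (edges F) * (\<Prod>i\<in>{1..k}. real (card (U i)))\<bar>
          \<le> \<epsilon> n * real (card (verts (G n))) ^ k)) \<longrightarrow>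
      quasi_random p G)"
proof (intro conjI iffI impI)
  note G = assms(1) and N = assms(2) and F = assms(3,4)
  have p: "0 \<le> p" using assms(6) by simp
  let ?N = "\<lambda>n. real (card (verts (G n)))"
  let ?dev = "\<lambda>n U. \<bar>real (num_inj_homs_in F (G n) U) - p ^ card (edges F) * (\<Prod>i\<in>{1..k}. real (card (U i)))\<bar>"
  let ?adm = "\<lambda>n U. \<forall>i\<in>{1..k}. U i \<subseteq> verts (G n) \<and> int (card (U i)) = \<lfloor>\<gamma> * ?N n\<rfloor>"
  {
    assume qr: "quasi_random p G"
    have "\<exists>\<epsilon>. \<epsilon> \<longlonglongrightarrow> 0 \<and> (\<forall>n U. ?adm n U \<longrightarrow> ?dev n U \<le> \<epsilon> n * ?N n ^ k)"
    proof (rule vanishing_error_sequence)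
      fix \<eta> :: real assume "\<eta> > 0"
      have "eventually (\<lambda>n. \<forall>U. (\<forall>i\<in>{1..k}. U i \<subseteq> verts (G n)) \<longrightarrow> ?dev n U \<le> \<eta> * ?N n ^ k) sequentially"
        by (rule cut_imp_counts[OF G N quasi_random_imp_cut[OF G qr] F p assms(7) \<open>\<eta> > 0\<close>])
      then show "eventually (\<lambda>n. \<forall>U. ?adm n U \<longrightarrow> ?dev n U \<le> \<eta> * ?N n ^ k) sequentially"
        by eventually_elim blast
    next
      \<comment> \<open>The trivial bound, valid for every \<open>n\<close>: the count and the main
        term both lie between 0 and \<open>?N n ^ k\<close>.\<close>
      fix n U assume U: "?adm n U"
      have V: "finite (verts (G n))" using G[of n] by (simp add: simple_graph_def)
      have "real (num_inj_homs_in F (G n) U) \<le> ?N n ^ k"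
        using num_inj_homs_in_le[OF F(2) V, of U] by (simp flip: of_nat_power)
      moreover have "p ^ card (edges F) * (\<Prod>i\<in>{1..k}. real (card (U i))) \<le> 1 * (\<Prod>i\<in>{1..k}. ?N n)"
      proof (intro mult_mono prod_mono)
        fix i assume "i \<in> {1..k}"
        then have "card (U i) \<le> card (verts (G n))" using U by (intro card_mono V) blast
        then show "0 \<le> real (card (U i)) \<and> real (card (U i)) \<le> ?N n" by simp
      qed (use p assms(7) in \<open>auto simp: power_le_one prod_nonneg\<close>)
      then have "p ^ card (edges F) * (\<Prod>i\<in>{1..k}. real (card (U i))) \<le> ?N n ^ k" by simp
      moreover have "0 \<le> p ^ card (edges F) * (\<Prod>i\<in>{1..k}. real (card (U i)))"
        using p by (simp add: prod_nonneg)
      ultimately show "?dev n U \<le> ?N n ^ k" by linarith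
    qed simp
    then show "\<exists>\<epsilon>. \<epsilon> \<longlonglongrightarrow> 0 \<and> (\<forall>n U. ?adm n U \<longrightarrow> ?dev n U \<le> \<epsilon> n * ?N n ^ k)" .
  }
  {
    assume "\<exists>\<epsilon>. \<epsilon> \<longlonglongrightarrow> 0 \<and> (\<forall>n U. ?adm n U \<longrightarrow> ?dev n U \<le> \<epsilon> n * ?N n ^ k)"
    then obtain \<epsilon> where \<epsilon>: "\<epsilon> \<longlonglongrightarrow> 0" "\<And>n U. ?adm n U \<Longrightarrow> ?dev n U \<le> \<epsilon> n * ?N n ^ k" by blast
    show "quasi_random p G"
    proof (rule cut_imp_quasi_random[OF G N _ p assms(7)])
      fix \<eta> :: real assume "\<eta> > 0"
      show "eventually (\<lambda>n. cut_small (verts (G n)) (\<lambda>u v. adj (G n) u v - p) \<eta>) sequentially"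
      proof (rule counts_imp_cut[OF G N F assms(5-9) _ \<epsilon>(1) _ \<open>\<eta> > 0\<close>, where D = False])
        fix n U assume "\<And>i. i \<in> {1..k} \<Longrightarrow> U i \<subseteq> verts (G n) \<and> int (card (U i)) = \<lfloor>\<gamma> * ?N n\<rfloor>"
        then show "?dev n U \<le> \<epsilon> n * ?N n ^ k" by (intro \<epsilon>(2)) blast
      qed simp
    qed
  }
  {
    assume \<gamma>: "\<gamma> < 1 / real k"
      and ex: "\<exists>\<epsilon>. \<epsilon> \<longlonglongrightarrow> 0 \<and> (\<forall>n U. ?adm n U \<and> (\<forall>i\<in>{1..k}. \<forall>j\<in>{1..k}. i \<noteq> j \<longrightarrow> U i \<inter> U j = {}) \<longrightarrow>
        ?dev n U \<le> \<epsilon> n * ?N n ^ k)"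
    from ex obtain \<epsilon> where \<epsilon>: "\<epsilon> \<longlonglongrightarrow> 0 \<and>
      (\<forall>n U. ?adm n U \<and> (\<forall>i\<in>{1..k}. \<forall>j\<in>{1..k}. i \<noteq> j \<longrightarrow> U i \<inter> U j = {}) \<longrightarrow> ?dev n U \<le> \<epsilon> n * ?N n ^ k)" ..
    show "quasi_random p G"
    proof (rule cut_imp_quasi_random[OF G N _ p assms(7)])
      fix \<eta> :: real assume "\<eta> > 0"
      show "eventually (\<lambda>n. cut_small (verts (G n)) (\<lambda>u v. adj (G n) u v - p) \<eta>) sequentially"
      proof (rule counts_imp_cut[OF G N F assms(5-9) \<gamma> \<epsilon>[THEN conjunct1] _ \<open>\<eta> > 0\<close>, where D = True])
        fix n U assume "\<And>i. i \<in> {1..k} \<Longrightarrow> U i \<subseteq> verts (G n) \<and> int (card (U i)) = \<lfloor>\<gamma> * ?N n\<rfloor>"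
          and "True \<longrightarrow> disjoint_family_on U {1..k}"
        then show "?dev n U \<le> \<epsilon> n * ?N n ^ k"
          by (intro \<epsilon>[THEN conjunct2, THEN spec, THEN spec, THEN mp]) (simp add: disjoint_family_on_def)
      qed
    qed
  }
qed

end
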